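(* Let $\mathcal H$ be a real Hilbert space and $\gamma>0$. Let $f\in C^2(\mathcal H)$ be real-valued with $\inf_{\mathcal H}f>-\infty$, with $\nabla f$ Lipschitz continuous on bounded sets, with $\nabla^2f:\mathcal H\to\mathcal L(\mathcal H)$ bounded on bounded sets and Lipschitz continuous in operator norm on every bounded set, and suppose there is $\kappa\ge0$ with $\langle\nabla^2f(x)u,u\rangle\ge-\kappa\|u\|^2$ for all $x,u\in\mathcal H$. Let $\phi:\mathcal H\to\mathbb R\cup\{+\infty\}$ be proper, lower semicontinuous and convex with $\phi(0)=\min\phi=0$ and $r\mathbb B\subseteq\partial\phi(0)$ for some $r>0$. Fix $x_0\in\mathcal H$, $v_0\in\mathrm{Dom}(\partial\phi)$, and $\bar\beta>0$ with $\bar\beta\kappa<\gamma$. For $0\le\beta\le\bar\beta$ let $(x_\beta^I,v_\beta^I)$ and $(x_\beta^E,v_\beta^E)$ be the global strong solutions, with the same initial data $x(0)=x_0$, $\dot x(0)=v_0$, of respectively $$\ddot x+\gamma\dot x+\partial\phi(\dot x)+\nabla f(x+\beta\dot x)\ni0\quad\text{and}\quad\ddot x+\gamma\dot x+\partial\phi(\dot x)+\beta\nabla^2f(x)\dot x+\nabla f(x)\ni0 ,$$ and let $(x^0,v^0)$ be their common solution for $\beta=0$. Let $T_\beta^I,T_\beta^E$ denote their permanent stopping times. Assume that $(x^0,v^0)$ has a finite permanent stopping time $T^0>0$ and that there exists $\delta>0$ with $$-\nabla f(x^0(T^0))+\delta\mathbb B\subseteq\partial\phi(0).$$ Then there exist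 $\beta_0,C>0$ (with $\beta_0\le\bar\beta$) such that, for $0<\beta\le\beta_0$, the stopping times $T_\beta^I,T_\beta^E$ are finite and $$|T_\beta^I-T_\beta^E|\le C\beta^2,$$ $$\sup_{t\ge0}\left(\|x_\beta^I(t)-x_\beta^E(t)\|+\|v_\beta^I(t)-v_\beta^E(t)\|\right)\le C\beta^2,$$ $$\|x_\beta^I(T_\beta^I)-x_\beta^E(T_\beta^E)\|\le C\beta^2 .$$ Moreover $|T_\beta^J-T^0|\le C\beta$ for $J\in\{I,E\}$.
   Context: $\mathbb B$ is the closed unit ball of $\mathcal H$; $\partial\phi$ is the convex subdifferential and $\mathrm{Dom}(\partial\phi)=\{v:\partial\phi(v)\neq\varnothing\}$. For a force $F(x,v)$ (here $\nabla f(x+\beta v)$ or $\nabla f(x)+\beta\nabla^2f(x)v$), a strong solution on $[0,T]$ is a pair $(x,v)$ with $x,v\in W^{1,2}(0,T;\mathcal H)$, $v=\dot x$ a.e., the given initial values, and some $\xi\in L^2(0,T;\mathcal H)$ with $\xi(t)\in\partial\phi(v(t))$ and $\dot v+\gamma v+\xi+F(x,v)=0$ a.e.; a global strong solution is one whose restriction to every $[0,T]$ is strong. Under the stated hypotheses both systems have unique global strong solutions for $0\le\beta\le\bar\beta$. The permanent stopping time of a trajectory $(x,v)$ is $\inf\{T\ge0: v(t)=0\text{ for every }t\ge T\}$, with $\inf\varnothing=+\infty$. *)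

theory Defs
  imports "HOL-Analysis.Analysis"
begin

definition proper_fun :: "('a \<Rightarrow> ereal) \<Rightarrow> bool" where
  "proper_fun \<phi> \<longleftrightarrow> (\<forall>x. \<phi> x \<noteq> -\<infinity>) \<and> (\<exists>x. \<phi> x \<noteq> \<infinity>)"

definition lsc_fun :: "('a::topological_space \<Rightarrow> ereal) \<Rightarrow> bool" where
  "lsc_fun \<phi> \<longleftrightarrow> (\<forall>x. \<phi> x \<le> Liminf (at x) \<phi>)"

(* The library predicate convex_on is for real-valued functions only.  The sum on the right
   is never of the form \<infinity> - \<infinity>, because the predicate is used together with proper_fun. *)
definition convex_fun :: "('a::real_vector \<Rightarrow> ereal) \<Rightarrow> bool" where
  "convex_fun \<phi> \<longleftrightarrow>
     (\<forall>x y. \<forall>s\<ge>0. \<forall>t\<ge>0. s + t = 1 \<longrightarrow>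
        \<phi> (s *\<^sub>R x + t *\<^sub>R y) \<le> ereal s * \<phi> x + ereal t * \<phi> y)"

definition subdifferential :: "('a::real_inner \<Rightarrow> ereal) \<Rightarrow> 'a \<Rightarrow> 'a set" where
  "subdifferential \<phi> v = {p. \<forall>w. \<phi> v + ereal (inner p (w - v)) \<le> \<phi> w}"

definition subdifferential_dom :: "('a::real_inner \<Rightarrow> ereal) \<Rightarrow> 'a set" where
  "subdifferential_dom \<phi> = {v. subdifferential \<phi> v \<noteq> {}}"

(* f is of class C^2 in the Frechet sense, with gradient g and Hessian H; both are uniquely
   determined by f.  The norm on the type of bounded linear maps is the operator norm. *)
definition C2_with ::
  "('a::real_inner \<Rightarrow> real) \<Rightarrow> ('a \<Rightarrow> 'a) \<Rightarrow> ('a \<Rightarrow> 'a \<Rightarrow>\<^sub>L 'a) \<Rightarrow> bool" where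
  "C2_with f g H \<longleftrightarrow>
     (\<forall>x. GDERIV f x :> g x) \<and>
     (\<forall>x. (g has_derivative blinfun_apply (H x)) (at x)) \<and>
     continuous_on UNIV H"

definition lipschitz_on_bounded :: "('a::metric_space \<Rightarrow> 'b::metric_space) \<Rightarrow> bool" where
  "lipschitz_on_bounded h \<longleftrightarrow> (\<forall>B. bounded B \<longrightarrow> (\<exists>L. L-lipschitz_on B h))"

definition bounded_on_bounded :: "('a::metric_space \<Rightarrow> 'b::metric_space) \<Rightarrow> bool" where
  "bounded_on_bounded h \<longleftrightarrow> (\<forall>B. bounded B \<longrightarrow> bounded (h ` B))"

(* The Bochner integral of HOL-Analysis requires a second countable codomain, hence a separable
   Hilbert space.  The library predicate measurable_on (almost everywhere limit of continuous
   functions) is strong measurability for functions of a real variable, without any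
   separability.  For the nonnegative function norm^2, gauge integrability is Lebesgue
   integrability. *)
definition L2_on :: "real \<Rightarrow> (real \<Rightarrow> 'a::real_normed_vector) \<Rightarrow> bool" where
  "L2_on T u \<longleftrightarrow> u measurable_on {0..T} \<and> (\<lambda>t. (norm (u t))\<^sup>2) integrable_on {0..T}"

(* x is the continuous representative of an element of W^{1,2}(0,T;H), with derivative u in
   L^2(0,T;H).  On L2_on functions the gauge integral agrees with the Bochner integral. *)
definition W12_deriv ::
  "real \<Rightarrow> (real \<Rightarrow> 'a::real_normed_vector) \<Rightarrow> (real \<Rightarrow> 'a) \<Rightarrow> bool" where
  "W12_deriv T x u \<longleftrightarrow>
     L2_on T u \<and> (\<forall>t\<in>{0..T}. (u has_integral (x t - x 0)) {0..t})"

definition strong_solution ::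
  "('a::real_inner \<Rightarrow> 'a \<Rightarrow> 'a) \<Rightarrow> real \<Rightarrow> ('a \<Rightarrow> ereal) \<Rightarrow> 'a \<Rightarrow> 'a \<Rightarrow> real
     \<Rightarrow> (real \<Rightarrow> 'a) \<Rightarrow> (real \<Rightarrow> 'a) \<Rightarrow> bool" where
  "strong_solution F \<gamma> \<phi> x\<^sub>0 v\<^sub>0 T x v \<longleftrightarrow>
     x 0 = x\<^sub>0 \<and> v 0 = v\<^sub>0 \<and>
     (\<exists>dx dv \<xi>. W12_deriv T x dx \<and> W12_deriv T v dv \<and> L2_on T \<xi> \<and>
        (AE t in lebesgue_on {0..T}. v t = dx t) \<and>
        (AE t in lebesgue_on {0..T}. \<xi> t \<in> subdifferential \<phi> (v t)) \<and>
        (AE t in lebesgue_on {0..T}. dv t + \<gamma> *\<^sub>R v t + \<xi> t + F (x t) (v t) = 0))"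

definition global_strong_solution ::
  "('a::real_inner \<Rightarrow> 'a \<Rightarrow> 'a) \<Rightarrow> real \<Rightarrow> ('a \<Rightarrow> ereal) \<Rightarrow> 'a \<Rightarrow> 'a
     \<Rightarrow> (real \<Rightarrow> 'a) \<Rightarrow> (real \<Rightarrow> 'a) \<Rightarrow> bool" where
  "global_strong_solution F \<gamma> \<phi> x\<^sub>0 v\<^sub>0 x v \<longleftrightarrow>
     (\<forall>T>0. strong_solution F \<gamma> \<phi> x\<^sub>0 v\<^sub>0 T x v)"

definition implicit_force :: "('a::real_vector \<Rightarrow> 'a) \<Rightarrow> real \<Rightarrow> 'a \<Rightarrow> 'a \<Rightarrow> 'a" where
  "implicit_force g \<beta> x v = g (x + \<beta> *\<^sub>R v)"

definition explicit_force ::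
  "('a::real_normed_vector \<Rightarrow> 'a) \<Rightarrow> ('a \<Rightarrow> 'a \<Rightarrow>\<^sub>L 'a) \<Rightarrow> real \<Rightarrow> 'a \<Rightarrow> 'a \<Rightarrow> 'a" where
  "explicit_force g H \<beta> x v = g x + \<beta> *\<^sub>R blinfun_apply (H x) v"

definition stopping_time :: "(real \<Rightarrow> 'a::zero) \<Rightarrow> ereal" where
  "stopping_time v = Inf {ereal T |T. 0 \<le> T \<and> (\<forall>t\<ge>T. v t = 0)}"

end

theory Submission
  imports Defs
begin

text \<open>
  The subdifferential of \<open>\<phi>\<close> is monotone, so for two strong solutions the squared distance
  \<open>\<parallel>x\<^sub>1 - x\<^sub>2\<parallel>\<^sup>2 + \<parallel>v\<^sub>1 - v\<^sub>2\<parallel>\<^sup>2\<close> satisfies a Gronwall inequality driven by the difference of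
  the forces.  On \<open>[0, T\<^sup>0 + 1]\<close> this puts both regularised trajectories within \<open>O(\<beta>)\<close> of the
  trajectory for \<open>\<beta> = 0\<close> (a continuity argument keeps them in a fixed ball, so no energy
  estimate is needed), and within \<open>O(\<beta>\<^sup>2)\<close> of each other, because the two forces differ by the
  second-order Taylor remainder of the gradient.

  Near the rest point the force stays \<open>\<delta>/2\<close>-inside the threshold set \<open>\<partial>\<phi>(0)\<close>, so dry friction
  decreases the speed at a uniform rate and a trajectory with speed \<open>\<eta>\<close> stops within time
  \<open>4\<eta>/\<delta>\<close>.  When one of two trajectories has stopped, the speed of the other is at most
  their distance; hence the stopping times differ by \<open>O(\<beta>)\<close> from \<open>T\<^sup>0\<close> and by \<open>O(\<beta>\<^sup>2)\<close> from one
  another.  After time \<open>T\<^sup>0 + 1\<close> nothing moves any more.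
\<close>

section \<open>Absolutely continuous curves in an inner product space\<close>

text \<open>Cut \<open>{a..b}\<close> into \<open>n\<close> equal pieces shorter than
  \<open>d\<close> and add the estimates: the right-hand side telescopes, so the factor
  \<open>e\<close> is not multiplied by the number of pieces.\<close>

lemma increment_le_telescope:
  fixes \<psi> G :: "real \<Rightarrow> real"
  assumes "a \<le> b" and "d > 0"
    and step: "\<And>s t. a \<le> s \<Longrightarrow> s \<le> t \<Longrightarrow> t \<le> b \<Longrightarrow> t - s < d \<Longrightarrow> \<bar>\<psi> t - \<psi> s\<bar> \<le> e * (G t - G s)"
  shows "\<bar>\<psi> b - \<psi> a\<bar> \<le> e * (G b - G a)"
proof -
  obtain n :: nat where n: "(b - a) / d < real n"
    using reals_Archimedean2 by blast
  have "0 \<le> (b - a) / d" using assms by simp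
  hence n0: "real n > 0" using n by linarith
  define p where "p i = a + real i * ((b - a) / real n)" for i
  have w: "0 \<le> (b - a) / real n" "(b - a) / real n < d"
    using n n0 assms by (auto simp: field_simps)
  have p0: "p 0 = a" and pn: "p n = b" using n0 by (auto simp: p_def)
  have pS: "p (Suc i) = p i + (b - a) / real n" for i
    by (simp add: p_def algebra_simps add_divide_distrib diff_divide_distrib)
  have ge: "a \<le> p i" for i
    using mult_nonneg_nonneg[OF of_nat_0_le_iff w(1), of i] by (simp add: p_def)
  have le: "p i \<le> b" if "i \<le> n" for i
  proof -
    have "real i * ((b - a) / real n) \<le> real n * ((b - a) / real n)"
      using that w by (intro mult_right_mono) auto
    thus ?thesis using n0 by (simp add: p_def)
  qed
  have "\<bar>\<psi> (p i) - \<psi> a\<bar> \<le> e * (G (p i) - G a)" if "i \<le> n" for i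
    using that
  proof (induction i)
    case 0
    then show ?case by (simp add: p0)
  next
    case (Suc i)
    have "\<bar>\<psi> (p (Suc i)) - \<psi> (p i)\<bar> \<le> e * (G (p (Suc i)) - G (p i))"
      by (rule step) (use ge le[OF Suc.prems] pS w in auto)
    with Suc show ?case by (simp add: right_diff_distrib)
  qed
  from this[of n] show ?thesis by (simp add: pn)
qed

text \<open>Multiply \<open>a + K * J t\<close>, with \<open>J\<close> the integral of
  \<open>e\<close>, by the integrating factor \<open>exp (- K * (t - s))\<close>. The product
  \<open>q\<close> has nonpositive derivative and equals \<open>a\<close> at time
  \<open>s\<close>.\<close>

lemma gronwall_integral:
  fixes e :: "real \<Rightarrow> real"
  assumes cont: "continuous_on {s..T} e" and "K \<ge> 0"
    and le: "\<And>t. t \<in> {s..T} \<Longrightarrow> e t \<le> a + K * integral {s..t} e"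
    and t: "t \<in> {s..T}"
  shows "e t \<le> a * exp (K * (t - s))"
proof -
  define J where "J t = integral {s..t} e" for t
  define q where "q t = (a + K * J t) * exp (- K * (t - s))" for t
  have J': "(J has_real_derivative e u) (at u within {s..T})" if "u \<in> {s..T}" for u
    unfolding J_def using cont that by (rule integral_has_real_derivative)
  have q': "(q has_real_derivative (K * exp (- K * (u - s)) * (e u - (a + K * J u)))) (at u within {s..T})"
    if "u \<in> {s..T}" for u
    unfolding q_def
    by (rule derivative_eq_intros J'[OF that] refl | simp add: algebra_simps)+
  have "q t \<le> q s"
  proof (rule DERIV_nonpos_imp_decreasing_open[where f = q])
    have "continuous_on {s..T} q"
      unfolding continuous_on_eq_continuous_within using DERIV_continuous[OF q'] by blast
    thus "continuous_on {s..t} q"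
      by (rule continuous_on_subset) (use t in auto)
    fix u assume u: "s < u" "u < t"
    hence "at u within {s..T} = at u"
      using t by (intro at_within_Icc_at) auto
    with q'[of u] u t
    have "(q has_real_derivative (K * exp (- K * (u - s)) * (e u - (a + K * J u)))) (at u)"
      by simp
    moreover have "K * exp (- K * (u - s)) * (e u - (a + K * J u)) \<le> 0"
      using le[of u] u t \<open>K \<ge> 0\<close> by (intro mult_nonneg_nonpos) (auto simp: J_def)
    ultimately show "\<exists>y. (q has_real_derivative y) (at u) \<and> y \<le> 0" by blast
  next
    show "s \<le> t" using t by simp
  qed
  hence "(a + K * J t) * exp (- K * (t - s)) \<le> a" by (simp add: q_def J_def)
  hence "(a + K * J t) * exp (- K * (t - s)) * exp (K * (t - s)) \<le> a * exp (K * (t - s))"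
    by (rule mult_right_mono) simp
  hence "a + K * J t \<le> a * exp (K * (t - s))"
    by (simp add: mult.assoc flip: exp_add)
  with le[OF t] show ?thesis by (simp add: J_def)
qed

section \<open>Curves with integrable derivative and their energy identity\<close>

text \<open>The \<open>L^1\<close> weakening of \<open>W12_deriv\<close>; closure under differences
  is then a matter of the triangle inequality. Measurability is a separate component because
  integrability of further functions is obtained from it by domination.\<close>

definition ac_deriv :: "real \<Rightarrow> (real \<Rightarrow> 'a::real_normed_vector) \<Rightarrow> (real \<Rightarrow> 'a) \<Rightarrow> bool" where
  "ac_deriv T w u \<longleftrightarrow> u measurable_on {0..T} \<and> (\<lambda>t. norm (u t)) integrable_on {0..T} \<and>
     (\<forall>t\<in>{0..T}. (u has_integral (w t - w 0)) {0..t})"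

lemma measurable_on_norm:
  assumes "f measurable_on S"
  shows "(\<lambda>x. norm (f x)) measurable_on S"
proof -
  have "(norm \<circ> f) measurable_on S"
    by (rule measurable_on_compose_continuous_0[OF assms]) (auto intro: continuous_intros)
  thus ?thesis unfolding o_def .
qed

lemma measurable_on_bounded_integrable_real:
  fixes f :: "real \<Rightarrow> real"
  assumes "f measurable_on {a..b}" and "g integrable_on {a..b}"
    and "\<And>t. t \<in> {a..b} \<Longrightarrow> \<bar>f t\<bar> \<le> g t"
  shows "f integrable_on {a..b}"
proof (rule measurable_bounded_by_integrable_imp_integrable_real[OF _ assms(2,3)])
  show "f \<in> borel_measurable (lebesgue_on {a..b})"
    using assms(1) by (subst (asm) measurable_on_iff_borel_measurable) auto
qed auto

lemma continuous_on_Icc_measurable_on: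
  fixes w :: "real \<Rightarrow> 'a::real_normed_vector"
  assumes "continuous_on {a..b} w"
  shows "w measurable_on {a..b}"
proof (cases "a \<le> b")
  case True
  \<comment> \<open>Clamping the argument to \<open>{a..b}\<close> extends \<open>w\<close>
    continuously to the whole line, where continuity gives measurability.\<close>
  have "continuous_on UNIV (\<lambda>t. w (max a (min b t)))"
    using True by (intro continuous_on_compose2[OF assms] continuous_intros) auto
  hence "(\<lambda>t. w (max a (min b t))) measurable_on UNIV"
    by (rule continuous_imp_measurable_on)
  hence "(\<lambda>t. if t \<in> {a..b} then w (max a (min b t)) else 0) measurable_on UNIV"
    by (rule measurable_on_restrict) auto
  hence "(\<lambda>t. w (max a (min b t))) measurable_on {a..b}"
    by (simp only: measurable_on_UNIV)
  thus ?thesis by (rule measurable_on_spike[of _ _ "{}"]) auto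
next
  case False
  show ?thesis by (rule measurable_on_spike[OF measurable_on_0, of "{}"]) (use False in simp_all)
qed

text \<open>On a bounded interval \<open>1 + (norm (u t))\<^sup>2\<close> is integrable and
  dominates \<open>norm (u t)\<close>.\<close>

lemma W12_deriv_imp_ac_deriv:
  assumes "W12_deriv T w u"
  shows "ac_deriv T w u"
proof -
  have m: "u measurable_on {0..T}" and i: "(\<lambda>t. (norm (u t))\<^sup>2) integrable_on {0..T}"
    using assms by (auto simp: W12_deriv_def L2_on_def)
  have "(\<lambda>t. norm (u t)) integrable_on {0..T}"
  proof (rule measurable_on_bounded_integrable_real)
    show "(\<lambda>t. 1 + (norm (u t))\<^sup>2) integrable_on {0..T}"
      using i by (intro integrable_add) auto
    show "\<bar>norm (u t)\<bar> \<le> 1 + (norm (u t))\<^sup>2" for t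
      using sum_squares_bound[of "norm (u t)" 1] norm_ge_zero[of "u t"]
      unfolding power_one mult_1_right abs_norm_cancel by linarith
  qed (intro measurable_on_norm m)
  thus ?thesis using assms m by (auto simp: ac_deriv_def W12_deriv_def)
qed

lemma ac_deriv_diff:
  assumes "ac_deriv T w u" "ac_deriv T w' u'"
  shows "ac_deriv T (\<lambda>t. w t - w' t) (\<lambda>t. u t - u' t)"
proof -
  have m: "(\<lambda>t. u t - u' t) measurable_on {0..T}"
    using assms by (auto simp: ac_deriv_def intro: measurable_on_diff)
  have "(\<lambda>t. norm (u t - u' t)) integrable_on {0..T}"
  proof (rule measurable_on_bounded_integrable_real)
    show "(\<lambda>t. norm (u t) + norm (u' t)) integrable_on {0..T}"
      using assms by (auto simp: ac_deriv_def intro!: integrable_add)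
  qed (auto intro: measurable_on_norm m norm_triangle_ineq4)
  moreover have "((\<lambda>t. u t - u' t) has_integral (w t - w' t - (w 0 - w' 0))) {0..t}"
    if "t \<in> {0..T}" for t
    using has_integral_diff[of u "w t - w 0" "{0..t}" u' "w' t - w' 0"] assms that
    by (simp add: ac_deriv_def algebra_simps)
  ultimately show ?thesis using m by (simp add: ac_deriv_def)
qed

text \<open>
  Integrals of vector-valued functions over subintervals, and continuity of the indefinite
  integral, are available in the library for the class \<^class>\<open>banach\<close> only, and the sort of
  complete inner product spaces is not an instance of it.  Testing against vectors reduces
  everything to real-valued functions.
\<close>
lemma ac_deriv_inner_has_integral:
  fixes w :: "real \<Rightarrow> 'a::real_inner"
  assumes "ac_deriv T w u" and "0 \<le> s" "s \<le> t" "t \<le> T"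
  shows "((\<lambda>\<tau>. inner (u \<tau>) a) has_integral inner (w t - w s) a) {s..t}"
proof -
  have "(u has_integral (w r - w 0)) {0..r}" if "r \<in> {0..T}" for r
    using assms that by (auto simp: ac_deriv_def)
  from has_integral_linear[OF this bounded_linear_inner_left[of a]]
  have *: "((\<lambda>\<tau>. inner (u \<tau>) a) has_integral inner (w r - w 0) a) {0..r}" if "r \<in> {0..T}" for r
    using that by (simp add: o_def)
  have 1: "((\<lambda>\<tau>. inner (u \<tau>) a) has_integral inner (w t - w 0) a) {0..t}"
    "((\<lambda>\<tau>. inner (u \<tau>) a) has_integral inner (w s - w 0) a) {0..s}"
    using assms by (auto intro!: *)
  have "(\<lambda>\<tau>. inner (u \<tau>) a) integrable_on {s..t}"
    by (rule integrable_subinterval_real[of _ 0 t]) (use 1 assms in auto)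
  then obtain I where I: "((\<lambda>\<tau>. inner (u \<tau>) a) has_integral I) {s..t}"
    by (auto simp: integrable_on_def)
  have "((\<lambda>\<tau>. inner (u \<tau>) a) has_integral (inner (w s - w 0) a + I)) {0..t}"
    by (rule has_integral_combine[OF _ _ 1(2) I]) (use assms in auto)
  from has_integral_unique[OF this 1(1)] have "I = inner (w t - w s) a"
    by (simp add: algebra_simps)
  with I show ?thesis by simp
qed

lemma ac_deriv_norm_integrable:
  assumes "ac_deriv T w u" and "0 \<le> s" "t \<le> T"
  shows "(\<lambda>\<tau>. norm (u \<tau>)) integrable_on {s..t}"
  by (rule integrable_subinterval_real[of _ 0 T]) (use assms in \<open>auto simp: ac_deriv_def\<close>)

lemma norm_le_of_inner_self_le:
  fixes a :: "'a::real_inner"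
  assumes "inner a a \<le> c * norm a" and "0 \<le> c"
  shows "norm a \<le> c"
proof (cases "a = 0")
  case False
  have "norm a * norm a \<le> c * norm a"
    using assms by (simp add: power2_norm_eq_inner flip: power2_eq_square)
  with False show ?thesis by simp
qed (use assms in simp)

text \<open>Test the curve against its own increment \<open>?a\<close>: Cauchy-Schwarz under the
  integral produces a factor \<open>norm ?a\<close>, which cancels against one factor of
  \<open>inner ?a ?a\<close>.\<close>

lemma ac_deriv_increment_le:
  fixes w :: "real \<Rightarrow> 'a::real_inner"
  assumes ac: "ac_deriv T w u" and st: "0 \<le> s" "s \<le> t" "t \<le> T"
  shows "norm (w t - w s) \<le> integral {s..t} (\<lambda>\<tau>. norm (u \<tau>))"
proof (rule norm_le_of_inner_self_le)
  let ?a = "w t - w s"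
  have "inner ?a ?a \<le> integral {s..t} (\<lambda>\<tau>. norm (u \<tau>) * norm ?a)"
  proof (rule has_integral_le)
    show "((\<lambda>\<tau>. inner (u \<tau>) ?a) has_integral inner ?a ?a) {s..t}"
      by (rule ac_deriv_inner_has_integral[OF ac st])
    show "((\<lambda>\<tau>. norm (u \<tau>) * norm ?a) has_integral integral {s..t} (\<lambda>\<tau>. norm (u \<tau>) * norm ?a)) {s..t}"
      using st by (intro integrable_integral integrable_on_mult_left ac_deriv_norm_integrable[OF ac])
  qed (rule norm_cauchy_schwarz)
  thus "inner ?a ?a \<le> integral {s..t} (\<lambda>\<tau>. norm (u \<tau>)) * norm ?a" by simp
  show "0 \<le> integral {s..t} (\<lambda>\<tau>. norm (u \<tau>))"
    by (intro integral_nonneg ac_deriv_norm_integrable[OF ac]) (use st in auto)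
qed

text \<open>Increments of \<open>w\<close> are dominated by increments of \<open>G\<close>, a real
  indefinite integral and hence continuous.\<close>

lemma ac_deriv_continuous_on:
  fixes w :: "real \<Rightarrow> 'a::real_inner"
  assumes ac: "ac_deriv T w u"
  shows "continuous_on {0..T} w"
proof -
  define G where "G t = integral {0..t} (\<lambda>\<tau>. norm (u \<tau>))" for t
  have "(\<lambda>\<tau>. norm (u \<tau>)) integrable_on {0..T}"
    by (rule ac_deriv_norm_integrable[OF ac]) auto
  hence G: "continuous_on {0..T} G"
    unfolding G_def by (rule indefinite_integral_continuous_1)
  have le: "dist (w t) (w s) \<le> dist (G t) (G s)" if "0 \<le> s" "s \<le> t" "t \<le> T" for s t
  proof -
    have "G t = G s + integral {s..t} (\<lambda>\<tau>. norm (u \<tau>))"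
      unfolding G_def
      by (rule Henstock_Kurzweil_Integration.integral_combine[symmetric]) (use that ac_deriv_norm_integrable[OF ac] in auto)
    with ac_deriv_increment_le[OF ac that] show ?thesis by (simp add: dist_norm)
  qed
  have le': "dist (w t) (w s) \<le> dist (G t) (G s)" if "s \<in> {0..T}" "t \<in> {0..T}" for s t
    using le[of s t] le[of t s] that by (cases "s \<le> t") (auto simp: dist_commute)
  show ?thesis
    using G unfolding continuous_on_iff by (meson le' le_less_trans)
qed

lemma ac_deriv_inner_integrable:
  fixes w :: "real \<Rightarrow> 'a::real_inner"
  assumes ac: "ac_deriv T w u" and "0 \<le> s" "t \<le> T"
  shows "(\<lambda>\<tau>. inner (u \<tau>) (w \<tau>)) integrable_on {s..t}"
proof -
  have c: "continuous_on {0..T} w" by (rule ac_deriv_continuous_on[OF ac])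
  have m: "u measurable_on {0..T}" and i: "(\<lambda>t. norm (u t)) integrable_on {0..T}"
    using ac by (auto simp: ac_deriv_def)
  have "bounded (w ` {0..T})"
    by (intro compact_imp_bounded compact_continuous_image c) auto
  then obtain W where W: "norm (w t) \<le> W" if "t \<in> {0..T}" for t
    unfolding bounded_iff by blast
  have "(\<lambda>\<tau>. inner (u \<tau>) (w \<tau>)) integrable_on {0..T}"
  proof (rule measurable_on_bounded_integrable_real)
    show "(\<lambda>\<tau>. inner (u \<tau>) (w \<tau>)) measurable_on {0..T}"
      by (rule measurable_on_combine[OF m continuous_on_Icc_measurable_on[OF c]])
        (auto intro!: continuous_intros)
    show "(\<lambda>\<tau>. W * norm (u \<tau>)) integrable_on {0..T}"
      using i by (intro integrable_on_mult_right)
    show "\<bar>inner (u \<tau>) (w \<tau>)\<bar> \<le> W * norm (u \<tau>)" if "\<tau> \<in> {0..T}" for \<tau>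
      using Cauchy_Schwarz_ineq2[of "u \<tau>" "w \<tau>"] mult_left_mono[OF W[OF that], of "norm (u \<tau>)"]
      by (simp add: mult.commute)
  qed
  thus ?thesis by (rule integrable_subinterval_real) (use assms in auto)
qed

text \<open>The chain rule for the squared norm, in integrated form. On a short interval the
  increment of the squared norm is the integral of \<open>u\<close> against the fixed vector
  \<open>w a + w b\<close>; by uniform continuity, replacing this vector by
  \<open>2 *\<^sub>R w \<tau>\<close> costs at most \<open>e * norm (u \<tau>)\<close>. Telescoping
  bounds the total defect by \<open>e * G t\<close>, and \<open>e\<close> is arbitrary.\<close>

lemma ac_deriv_energy:
  fixes w :: "real \<Rightarrow> 'a::real_inner"
  assumes ac: "ac_deriv T w u" and st: "0 \<le> s" "s \<le> t" "t \<le> T"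
  shows "((\<lambda>\<tau>. 2 * inner (u \<tau>) (w \<tau>)) has_integral ((norm (w t))\<^sup>2 - (norm (w s))\<^sup>2)) {s..t}"
proof -
  define h where "h \<tau> = 2 * inner (u \<tau>) (w \<tau>)" for \<tau>
  define \<psi> where "\<psi> \<tau> = (norm (w \<tau>))\<^sup>2 - integral {s..\<tau>} h" for \<tau>
  define G where "G \<tau> = integral {s..\<tau>} (\<lambda>t. norm (u t))" for \<tau>
  have hi: "h integrable_on {a..b}" if "s \<le> a" "b \<le> t" for a b
    unfolding h_def using that st
    by (intro integrable_on_mult_right ac_deriv_inner_integrable[OF ac]) auto
  have ui: "(\<lambda>t. norm (u t)) integrable_on {a..b}" if "s \<le> a" "b \<le> t" for a b
    by (rule integrable_subinterval_real[of _ 0 T]) (use that st ac in \<open>auto simp: ac_deriv_def\<close>)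
  have unif: "uniformly_continuous_on {s..t} w"
    by (intro compact_uniformly_continuous continuous_on_subset[OF ac_deriv_continuous_on[OF ac]])
      (use st in auto)
  have G0: "0 \<le> G t" unfolding G_def by (intro integral_nonneg ui) auto
  have small: "\<bar>\<psi> t - \<psi> s\<bar> \<le> e * G t" if e: "e > 0" for e
  proof -
    from unif e obtain d where d: "d > 0"
      and osc: "\<And>a b. a \<in> {s..t} \<Longrightarrow> b \<in> {s..t} \<Longrightarrow> dist a b < d \<Longrightarrow> dist (w a) (w b) < e / 2"
      unfolding uniformly_continuous_on_def by (metis half_gt_zero)
    have "\<bar>\<psi> t - \<psi> s\<bar> \<le> e * (G t - G s)"
    proof (rule increment_le_telescope[OF st(2) d])
      fix a b assume ab: "s \<le> a" "a \<le> b" "b \<le> t" "b - a < d"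
      have "inner (w b - w a) (w a + w b) = (norm (w b))\<^sup>2 - (norm (w a))\<^sup>2"
        by (simp add: power2_norm_eq_inner inner_diff_left inner_add_right inner_commute[of "w b" "w a"])
      with ac_deriv_inner_has_integral[OF ac, of a b "w a + w b"] ab st
      have I: "((\<lambda>\<tau>. inner (u \<tau>) (w a + w b)) has_integral ((norm (w b))\<^sup>2 - (norm (w a))\<^sup>2)) {a..b}"
        by simp
      have hd: "integral {s..b} h = integral {s..a} h + integral {a..b} h"
        by (rule Henstock_Kurzweil_Integration.integral_combine[symmetric]) (use ab hi in auto)
      have Gd: "G b = G a + integral {a..b} (\<lambda>t. norm (u t))"
        unfolding G_def by (rule Henstock_Kurzweil_Integration.integral_combine[symmetric]) (use ab ui in auto)
      have "\<psi> b - \<psi> a = ((norm (w b))\<^sup>2 - (norm (w a))\<^sup>2) - integral {a..b} h"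
        by (simp add: \<psi>_def hd)
      also have "\<dots> = integral {a..b} (\<lambda>\<tau>. inner (u \<tau>) (w a + w b) - h \<tau>)"
        using Henstock_Kurzweil_Integration.integral_diff[OF has_integral_integrable[OF I] hi[of a b]] I ab
        by (simp add: integral_unique)
      also have "norm \<dots> \<le> integral {a..b} (\<lambda>\<tau>. e * norm (u \<tau>))"
      proof (rule Henstock_Kurzweil_Integration.integral_norm_bound_integral)
        show "(\<lambda>\<tau>. inner (u \<tau>) (w a + w b) - h \<tau>) integrable_on {a..b}"
          using I hi ab by (intro integrable_diff) auto
        show "(\<lambda>\<tau>. e * norm (u \<tau>)) integrable_on {a..b}"
          using ui ab by (intro integrable_on_mult_right) auto
        fix \<tau> assume \<tau>: "\<tau> \<in> {a..b}"
        have "norm (w a - w \<tau>) < e / 2" "norm (w b - w \<tau>) < e / 2"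
          using osc[of a \<tau>] osc[of b \<tau>] \<tau> ab by (auto simp: dist_norm)
        hence "norm ((w a - w \<tau>) + (w b - w \<tau>)) \<le> e"
          using norm_triangle_ineq[of "w a - w \<tau>" "w b - w \<tau>"] by linarith
        hence "norm (u \<tau>) * norm ((w a - w \<tau>) + (w b - w \<tau>)) \<le> norm (u \<tau>) * e"
          by (intro mult_left_mono) auto
        moreover have "inner (u \<tau>) (w a + w b) - h \<tau> = inner (u \<tau>) ((w a - w \<tau>) + (w b - w \<tau>))"
          by (simp add: h_def algebra_simps inner_simps)
        ultimately show "norm (inner (u \<tau>) (w a + w b) - h \<tau>) \<le> e * norm (u \<tau>)"
          using Cauchy_Schwarz_ineq2[of "u \<tau>" "(w a - w \<tau>) + (w b - w \<tau>)"]
          by (simp add: mult.commute)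
      qed
      also have "\<dots> = e * (G b - G a)" by (simp add: Gd)
      finally show "\<bar>\<psi> b - \<psi> a\<bar> \<le> e * (G b - G a)" by simp
    qed
    thus ?thesis by (simp add: G_def)
  qed
  have "\<bar>\<psi> t - \<psi> s\<bar> \<le> 0"
  proof (rule field_le_epsilon)
    fix e :: real assume "e > 0"
    \<comment> \<open>The summand 1 keeps the denominator positive when
      \<open>G t = 0\<close>.\<close>
    hence "\<bar>\<psi> t - \<psi> s\<bar> \<le> e / (G t + 1) * G t" using G0 by (intro small) auto
    also have "\<dots> \<le> e" using G0 \<open>e > 0\<close> by (simp add: field_simps)
    finally show "\<bar>\<psi> t - \<psi> s\<bar> \<le> 0 + e" by simp
  qed
  hence "integral {s..t} h = (norm (w t))\<^sup>2 - (norm (w s))\<^sup>2" by (simp add: \<psi>_def)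
  with hi[of s t] have "(h has_integral ((norm (w t))\<^sup>2 - (norm (w s))\<^sup>2)) {s..t}"
    by (metis has_integral_integrable_integral order_refl)
  thus ?thesis by (simp add: h_def[abs_def])
qed

section \<open>Comparison and finite-time stopping of strong solutions\<close>

text \<open>Adding the two subgradient inequalities cancels the values of \<open>\<phi>\<close>,
  once these are known to be finite: \<open>\<phi> a = \<infinity>\<close> at a point with a
  subgradient would make \<open>\<phi>\<close> infinite everywhere, against properness.\<close>

lemma subdifferential_monotone:
  assumes "proper_fun \<phi>" and p: "p \<in> subdifferential \<phi> v" and q: "q \<in> subdifferential \<phi> w"
  shows "0 \<le> inner (p - q) (v - w)"
proof -
  obtain z where z: "\<phi> z \<noteq> \<infinity>" and nm: "\<And>x. \<phi> x \<noteq> -\<infinity>"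
    using \<open>proper_fun \<phi>\<close> by (auto simp: proper_fun_def)
  have fin: "\<phi> a \<noteq> \<infinity>" if "b \<in> subdifferential \<phi> a" for a b
  proof
    assume "\<phi> a = \<infinity>"
    moreover have "\<phi> a + ereal (inner b (z - a)) \<le> \<phi> z"
      using that by (simp add: subdifferential_def)
    ultimately show False using z by simp
  qed
  obtain a b where ab: "\<phi> v = ereal a" "\<phi> w = ereal b"
    using fin[OF p] fin[OF q] nm by (metis ereal_cases)
  have "\<phi> v + ereal (inner p (w - v)) \<le> \<phi> w" "\<phi> w + ereal (inner q (v - w)) \<le> \<phi> v"
    using p q by (auto simp: subdifferential_def)
  hence "a + inner p (w - v) \<le> b" "b + inner q (v - w) \<le> a" by (auto simp: ab)
  thus ?thesis by (simp add: inner_diff_left inner_diff_right)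
qed

lemma has_integral_le_off_negligible:
  fixes f g :: "real \<Rightarrow> real"
  assumes f: "(f has_integral i) S" and g: "(g has_integral j) S" and N: "negligible N"
    and le: "\<And>x. x \<in> S - N \<Longrightarrow> f x \<le> g x"
  shows "i \<le> j"
proof (rule has_integral_le)
  \<comment> \<open>Replacing \<open>f\<close> by \<open>g\<close> on the null set makes the
    comparison hold at every point.\<close>
  show "((\<lambda>x. if x \<in> N then g x else f x) has_integral i) S"
    by (rule has_integral_spike[OF N _ f]) auto
qed (use g le in auto)

lemma AE_lebesgue_on_negligibleE:
  assumes "AE t in lebesgue_on {a..b::real}. P t"
  obtains N where "negligible N" "\<And>t. t \<in> {a..b} - N \<Longrightarrow> P t"
proof -
  have "AE t in lebesgue. t \<in> {a..b} \<longrightarrow> P t"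
    using assms by (subst (asm) AE_restrict_space_iff) auto
  then obtain N where "negligible N" "{t. \<not> (t \<in> {a..b} \<longrightarrow> P t)} \<subseteq> N"
    by (auto simp: eventually_ae_filter_negligible)
  thus ?thesis by (intro that[of N]) auto
qed

text \<open>Merges the three almost-everywhere conditions into one null set and solves the inclusion
  for \<open>dv\<close>, ready for pointwise estimates.\<close>

lemma strong_solutionE:
  assumes "strong_solution F \<gamma> \<phi> x\<^sub>0 v\<^sub>0 T x v"
  obtains dx dv \<xi> N where "ac_deriv T x dx" "ac_deriv T v dv" "negligible N"
    "\<And>t. t \<in> {0..T} - N \<Longrightarrow> dx t = v t"
    "\<And>t. t \<in> {0..T} - N \<Longrightarrow> \<xi> t \<in> subdifferential \<phi> (v t)"
    "\<And>t. t \<in> {0..T} - N \<Longrightarrow> dv t = - (\<gamma> *\<^sub>R v t) - \<xi> t - F (x t) (v t)"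
proof -
  from assms obtain dx dv \<xi> where *: "W12_deriv T x dx" "W12_deriv T v dv"
    and ae: "AE t in lebesgue_on {0..T}. v t = dx t"
      "AE t in lebesgue_on {0..T}. \<xi> t \<in> subdifferential \<phi> (v t)"
      "AE t in lebesgue_on {0..T}. dv t + \<gamma> *\<^sub>R v t + \<xi> t + F (x t) (v t) = 0"
    unfolding strong_solution_def by blast
  obtain N1 where N1: "negligible N1" "\<And>t. t \<in> {0..T} - N1 \<Longrightarrow> dx t = v t"
    by (rule AE_lebesgue_on_negligibleE[OF ae(1)]) metis
  obtain N2 where N2: "negligible N2" "\<And>t. t \<in> {0..T} - N2 \<Longrightarrow> \<xi> t \<in> subdifferential \<phi> (v t)"
    by (rule AE_lebesgue_on_negligibleE[OF ae(2)]) blast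
  obtain N3 where N3: "negligible N3"
    "\<And>t. t \<in> {0..T} - N3 \<Longrightarrow> dv t + \<gamma> *\<^sub>R v t + \<xi> t + F (x t) (v t) = 0"
    by (rule AE_lebesgue_on_negligibleE[OF ae(3)]) blast
  show ?thesis
  proof (rule that[of dx dv "N1 \<union> N2 \<union> N3" \<xi>])
    show "dv t = - (\<gamma> *\<^sub>R v t) - \<xi> t - F (x t) (v t)" if "t \<in> {0..T} - (N1 \<union> N2 \<union> N3)" for t
    proof -
      have "dv t = (dv t + \<gamma> *\<^sub>R v t + \<xi> t + F (x t) (v t)) - \<gamma> *\<^sub>R v t - \<xi> t - F (x t) (v t)" by simp
      also have "dv t + \<gamma> *\<^sub>R v t + \<xi> t + F (x t) (v t) = 0" using N3(2)[of t] that by auto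
      finally show ?thesis by simp
    qed
  qed (use N1 N2 N3 * in \<open>auto intro: W12_deriv_imp_ac_deriv\<close>)
qed

lemma strong_solution_continuous_on:
  assumes "strong_solution F \<gamma> \<phi> x\<^sub>0 v\<^sub>0 T x v"
  shows "continuous_on {0..T} x" "continuous_on {0..T} v"
  using strong_solutionE[OF assms] ac_deriv_continuous_on by metis+

lemma strong_solution_displacement_le:
  assumes sol: "strong_solution F \<gamma> \<phi> x\<^sub>0 v\<^sub>0 T x v" and st: "0 \<le> s" "s \<le> t" "t \<le> T"
    and B: "\<And>\<tau>. \<tau> \<in> {s..t} \<Longrightarrow> norm (v \<tau>) \<le> B"
  shows "norm (x t - x s) \<le> B * (t - s)"
proof -
  obtain dx dv \<xi> N where ac: "ac_deriv T x dx" and N: "negligible N"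
    and dx: "\<And>t. t \<in> {0..T} - N \<Longrightarrow> dx t = v t"
    by (rule strong_solutionE[OF sol]) blast
  have "integral {s..t} (\<lambda>\<tau>. norm (dx \<tau>)) \<le> B * (t - s)"
  proof (rule has_integral_le_off_negligible[OF _ _ N])
    show "((\<lambda>\<tau>. norm (dx \<tau>)) has_integral integral {s..t} (\<lambda>\<tau>. norm (dx \<tau>))) {s..t}"
      by (intro integrable_integral ac_deriv_norm_integrable[OF ac] st)
    show "((\<lambda>_. B) has_integral B * (t - s)) {s..t}"
      using has_integral_const_real[of B s t] st by (simp add: mult.commute)
  qed (use dx B st in auto)
  with ac_deriv_increment_le[OF ac st] show ?thesis by linarith
qed

section \<open>Gronwall comparison of two solutions\<close>

text \<open>In the derivative of the summed squares, damping and the subdifferential contribute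
  nonpositive terms, the latter by monotonicity. The position term and the force difference are
  bounded with Young's inequality by \<open>m\<^sup>2\<close> plus a multiple of the same
  sum.\<close>

lemma strong_solution_compare:
  fixes x1 x2 :: "real \<Rightarrow> 'a::real_inner"
  assumes "\<gamma> \<ge> 0" and "proper_fun \<phi>"
    and sol1: "strong_solution F1 \<gamma> \<phi> a1 b1 T x1 v1"
    and sol2: "strong_solution F2 \<gamma> \<phi> a2 b2 T x2 v2"
    and st: "0 \<le> s" "s \<le> t" "t \<le> T" and "A \<ge> 0"
    and F: "\<And>\<tau>. \<tau> \<in> {s..t} \<Longrightarrow> norm (F1 (x1 \<tau>) (v1 \<tau>) - F2 (x2 \<tau>) (v2 \<tau>))
        \<le> A * (norm (x1 \<tau> - x2 \<tau>) + norm (v1 \<tau> - v2 \<tau>)) + m"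
  shows "(norm (x1 t - x2 t))\<^sup>2 + (norm (v1 t - v2 t))\<^sup>2
    \<le> ((norm (x1 s - x2 s))\<^sup>2 + (norm (v1 s - v2 s))\<^sup>2 + m\<^sup>2 * (t - s)) * exp ((2 + 3 * A) * (t - s))"
proof -
  \<comment> \<open>Young's inequality leaves the coefficient \<open>1 + A\<close> for the squared
    position difference and \<open>2 + 3 * A\<close> for the squared velocity difference;
    \<open>K\<close> is the larger one.\<close>
  define K where "K = 2 + 3 * A"
  have K: "K \<ge> 0" using \<open>A \<ge> 0\<close> by (simp add: K_def)
  define e where "e \<tau> = (norm (x1 \<tau> - x2 \<tau>))\<^sup>2 + (norm (v1 \<tau> - v2 \<tau>))\<^sup>2" for \<tau>
  obtain dx1 dv1 \<xi>1 N1 where 1: "ac_deriv T x1 dx1" "ac_deriv T v1 dv1" "negligible N1"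
    "\<And>t. t \<in> {0..T} - N1 \<Longrightarrow> dx1 t = v1 t"
    "\<And>t. t \<in> {0..T} - N1 \<Longrightarrow> \<xi>1 t \<in> subdifferential \<phi> (v1 t)"
    "\<And>t. t \<in> {0..T} - N1 \<Longrightarrow> dv1 t = - (\<gamma> *\<^sub>R v1 t) - \<xi>1 t - F1 (x1 t) (v1 t)"
    by (rule strong_solutionE[OF sol1]) blast
  obtain dx2 dv2 \<xi>2 N2 where 2: "ac_deriv T x2 dx2" "ac_deriv T v2 dv2" "negligible N2"
    "\<And>t. t \<in> {0..T} - N2 \<Longrightarrow> dx2 t = v2 t"
    "\<And>t. t \<in> {0..T} - N2 \<Longrightarrow> \<xi>2 t \<in> subdifferential \<phi> (v2 t)"
    "\<And>t. t \<in> {0..T} - N2 \<Longrightarrow> dv2 t = - (\<gamma> *\<^sub>R v2 t) - \<xi>2 t - F2 (x2 t) (v2 t)"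
    by (rule strong_solutionE[OF sol2]) blast
  have acy: "ac_deriv T (\<lambda>t. x1 t - x2 t) (\<lambda>t. dx1 t - dx2 t)"
    and acw: "ac_deriv T (\<lambda>t. v1 t - v2 t) (\<lambda>t. dv1 t - dv2 t)"
    by (rule ac_deriv_diff[OF 1(1) 2(1)], rule ac_deriv_diff[OF 1(2) 2(2)])
  have cont: "continuous_on {0..T} e"
    unfolding e_def by (intro continuous_intros ac_deriv_continuous_on[OF acy] ac_deriv_continuous_on[OF acw])
  have N: "negligible (N1 \<union> N2)" using 1 2 by auto
  have pointwise: "2 * inner (dx1 \<tau> - dx2 \<tau>) (x1 \<tau> - x2 \<tau>) + 2 * inner (dv1 \<tau> - dv2 \<tau>) (v1 \<tau> - v2 \<tau>)
      \<le> m\<^sup>2 + K * e \<tau>" if \<tau>: "\<tau> \<in> {s..t} - (N1 \<union> N2)" for \<tau>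
  proof -
    define y w D where "y = x1 \<tau> - x2 \<tau>" and "w = v1 \<tau> - v2 \<tau>"
      and "D = F1 (x1 \<tau>) (v1 \<tau>) - F2 (x2 \<tau>) (v2 \<tau>)"
    have mono: "0 \<le> inner (\<xi>1 \<tau> - \<xi>2 \<tau>) w"
      unfolding w_def by (rule subdifferential_monotone[OF \<open>proper_fun \<phi>\<close>]) (use 1 2 \<tau> st in auto)
    have dv: "dv1 \<tau> = - (\<gamma> *\<^sub>R v1 \<tau>) - \<xi>1 \<tau> - F1 (x1 \<tau>) (v1 \<tau>)"
      "dv2 \<tau> = - (\<gamma> *\<^sub>R v2 \<tau>) - \<xi>2 \<tau> - F2 (x2 \<tau>) (v2 \<tau>)"
      by (rule 1 2; use \<tau> st in auto)+
    have "dv1 \<tau> - dv2 \<tau> = - (\<gamma> *\<^sub>R w) - (\<xi>1 \<tau> - \<xi>2 \<tau>) - D"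
      unfolding dv by (simp add: w_def D_def algebra_simps)
    hence "inner (dv1 \<tau> - dv2 \<tau>) w = - \<gamma> * inner w w - inner (\<xi>1 \<tau> - \<xi>2 \<tau>) w - inner D w"
      by (simp add: inner_diff_left)
    also have "\<dots> \<le> norm D * norm w"
      using mono \<open>\<gamma> \<ge> 0\<close> Cauchy_Schwarz_ineq2[of D w] inner_ge_zero[of w]
        mult_nonneg_nonneg[of \<gamma> "inner w w"] by linarith
    also have "\<dots> \<le> (A * (norm y + norm w) + m) * norm w"
      using F[of \<tau>] \<tau> by (intro mult_right_mono) (auto simp: D_def y_def w_def)
    finally have a: "2 * inner (dv1 \<tau> - dv2 \<tau>) w
        \<le> A * (2 * (norm y * norm w)) + 2 * A * (norm w)\<^sup>2 + 2 * (m * norm w)"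
      by (simp add: algebra_simps power2_eq_square)
    have b: "2 * inner (dx1 \<tau> - dx2 \<tau>) y \<le> 2 * (norm y * norm w)"
      using 1(4)[of \<tau>] 2(4)[of \<tau>] \<tau> st norm_cauchy_schwarz[of w y] by (simp add: w_def mult.commute)
    have c: "2 * (norm y * norm w) \<le> (norm y)\<^sup>2 + (norm w)\<^sup>2" "2 * (m * norm w) \<le> m\<^sup>2 + (norm w)\<^sup>2"
      using sum_squares_bound[of "norm y" "norm w"] sum_squares_bound[of m "norm w"] by auto
    have d: "A * (2 * (norm y * norm w)) \<le> A * ((norm y)\<^sup>2 + (norm w)\<^sup>2)"
      using c \<open>A \<ge> 0\<close> by (intro mult_left_mono)
    have "0 \<le> (1 + 2 * A) * (norm y)\<^sup>2" using \<open>A \<ge> 0\<close> by simp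
    with a b c d show ?thesis
      unfolding e_def K_def y_def[symmetric] w_def[symmetric] by (simp add: algebra_simps)
  qed
  have le: "e r \<le> (e s + m\<^sup>2 * (t - s)) + K * integral {s..r} e" if r: "r \<in> {s..t}" for r
  proof -
    have sr: "0 \<le> s" "s \<le> r" "r \<le> T" using r st by auto
    have "e r - e s \<le> m\<^sup>2 * (r - s) + K * integral {s..r} e"
    proof (rule has_integral_le_off_negligible[OF _ _ N])
      show "((\<lambda>\<tau>. 2 * inner (dx1 \<tau> - dx2 \<tau>) (x1 \<tau> - x2 \<tau>) + 2 * inner (dv1 \<tau> - dv2 \<tau>) (v1 \<tau> - v2 \<tau>))
          has_integral e r - e s) {s..r}"
        using has_integral_add[OF ac_deriv_energy[OF acy sr] ac_deriv_energy[OF acw sr]]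
        by (simp add: e_def algebra_simps)
      have "e integrable_on {s..r}"
        by (intro integrable_continuous_real continuous_on_subset[OF cont]) (use sr in auto)
      from has_integral_add[OF has_integral_const_real[of "m\<^sup>2" s r]
          has_integral_mult_right[OF integrable_integral[OF this], of K]]
      show "((\<lambda>\<tau>. m\<^sup>2 + K * e \<tau>) has_integral m\<^sup>2 * (r - s) + K * integral {s..r} e) {s..r}"
        using sr by (simp add: mult.commute)
    qed (use pointwise r in auto)
    moreover have "m\<^sup>2 * (r - s) \<le> m\<^sup>2 * (t - s)" using r by (intro mult_left_mono) auto
    ultimately show ?thesis by simp
  qed
  have "e t \<le> (e s + m\<^sup>2 * (t - s)) * exp (K * (t - s))"
  proof (rule gronwall_integral[OF _ K le])
    show "continuous_on {s..t} e" by (rule continuous_on_subset[OF cont]) (use st in auto)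
  qed (use st in auto)
  thus ?thesis by (simp add: e_def K_def)
qed

section \<open>Dry friction and stopping in finite time\<close>

text \<open>Friction outweighs the force by \<open>d / 2\<close>, so the squared speed has
  derivative at most \<open>- d * norm (v \<tau>)\<close>. Hence the speed is nonincreasing, and
  \<open>norm (v \<tau>)\<close> may be replaced by the smaller \<open>norm (v t)\<close> before
  integrating over the whole interval.\<close>

lemma strong_solution_norm_decay:
  assumes "\<gamma> \<ge> 0" and "proper_fun \<phi>"
    and sol: "strong_solution F \<gamma> \<phi> x\<^sub>0 v\<^sub>0 T x v"
    and st: "0 \<le> s" "s \<le> t" "t \<le> T"
    and "d \<ge> 0" and d: "cball p d \<subseteq> subdifferential \<phi> 0"
    and F: "\<And>\<tau>. \<tau> \<in> {s..t} \<Longrightarrow> norm (F (x \<tau>) (v \<tau>) + p) \<le> d / 2"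
  shows "norm (v t) \<le> norm (v s)" and "(norm (v t))\<^sup>2 + d * (t - s) * norm (v t) \<le> (norm (v s))\<^sup>2"
proof -
  obtain dx dv \<xi> N where ac: "ac_deriv T v dv" and N: "negligible N"
    and \<xi>: "\<And>t. t \<in> {0..T} - N \<Longrightarrow> \<xi> t \<in> subdifferential \<phi> (v t)"
    and dv: "\<And>t. t \<in> {0..T} - N \<Longrightarrow> dv t = - (\<gamma> *\<^sub>R v t) - \<xi> t - F (x t) (v t)"
    by (rule strong_solutionE[OF sol]) blast
  have pointwise: "2 * inner (dv \<tau>) (v \<tau>) \<le> - d * norm (v \<tau>)" if \<tau>: "\<tau> \<in> {s..t} - N" for \<tau>
  proof -
    \<comment> \<open>The vector \<open>- F (x \<tau>) (v \<tau>)\<close> is within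
      \<open>d / 2\<close> of \<open>p\<close>; the remaining margin in the ball is spent in the
      direction of motion. Monotonicity between \<open>\<xi> \<tau>\<close> and \<open>q\<close>
      then yields the decay.\<close>
    define q where "q = - F (x \<tau>) (v \<tau>) + (d / 2) *\<^sub>R sgn (v \<tau>)"
    have "norm (p - q) \<le> norm (F (x \<tau>) (v \<tau>) + p) + norm ((d / 2) *\<^sub>R sgn (v \<tau>))"
      using norm_triangle_ineq4[of "F (x \<tau>) (v \<tau>) + p" "(d / 2) *\<^sub>R sgn (v \<tau>)"]
      by (simp add: q_def algebra_simps)
    also have "\<dots> \<le> d / 2 + d / 2"
      using F[of \<tau>] \<tau> \<open>d \<ge> 0\<close> by (intro add_mono) (auto simp: norm_sgn)
    finally have "q \<in> subdifferential \<phi> 0" using d by (auto simp: dist_norm)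
    with subdifferential_monotone[OF \<open>proper_fun \<phi>\<close> \<xi>[of \<tau>], of q 0] \<tau> st
    have "0 \<le> inner (\<xi> \<tau> - q) (v \<tau>)" by auto
    moreover have "inner (sgn (v \<tau>)) (v \<tau>) = norm (v \<tau>)"
      by (simp add: sgn_div_norm power2_norm_eq_inner[symmetric] power2_eq_square field_simps)
    ultimately have "(d / 2) * norm (v \<tau>) \<le> inner (\<xi> \<tau> + F (x \<tau>) (v \<tau>)) (v \<tau>)"
      by (simp add: q_def inner_add_left inner_diff_left)
    moreover have "inner (dv \<tau>) (v \<tau>) = - \<gamma> * inner (v \<tau>) (v \<tau>) - inner (\<xi> \<tau> + F (x \<tau>) (v \<tau>)) (v \<tau>)"
      using dv[of \<tau>] \<tau> st by (simp add: inner_add_left inner_diff_left)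
    moreover have "0 \<le> \<gamma> * inner (v \<tau>) (v \<tau>)" using \<open>\<gamma> \<ge> 0\<close> by simp
    ultimately show ?thesis by simp
  qed
  have mono: "norm (v t) \<le> norm (v r)" if r: "r \<in> {s..t}" for r
  proof -
    have "(norm (v t))\<^sup>2 - (norm (v r))\<^sup>2 \<le> 0"
    proof (rule has_integral_le_off_negligible[OF ac_deriv_energy[OF ac] has_integral_0 N])
      fix \<tau> assume "\<tau> \<in> {r..t} - N"
      hence "2 * inner (dv \<tau>) (v \<tau>) \<le> - d * norm (v \<tau>)" using r by (intro pointwise) auto
      moreover have "0 \<le> d * norm (v \<tau>)" using \<open>d \<ge> 0\<close> by simp
      ultimately show "2 * inner (dv \<tau>) (v \<tau>) \<le> 0" by linarith
    qed (use r st in auto)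
    thus ?thesis by (simp add: power2_le_iff_abs_le)
  qed
  show "norm (v t) \<le> norm (v s)" using mono st by auto
  have "(norm (v t))\<^sup>2 - (norm (v s))\<^sup>2 \<le> (t - s) * (- d * norm (v t))"
  proof (rule has_integral_le_off_negligible[OF ac_deriv_energy[OF ac st] _ N])
    show "((\<lambda>\<tau>. - d * norm (v t)) has_integral (t - s) * (- d * norm (v t))) {s..t}"
      using has_integral_const_real[of "- d * norm (v t)" s t] st by simp
    fix \<tau> assume \<tau>: "\<tau> \<in> {s..t} - N"
    with mono[of \<tau>] \<open>d \<ge> 0\<close> have "d * norm (v t) \<le> d * norm (v \<tau>)" by (intro mult_left_mono) auto
    with pointwise[OF \<tau>] show "2 * inner (dv \<tau>) (v \<tau>) \<le> - d * norm (v t)" by simp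
  qed
  thus "(norm (v t))\<^sup>2 + d * (t - s) * norm (v t) \<le> (norm (v s))\<^sup>2"
    by (simp add: algebra_simps)
qed

text \<open>The quadratic decay estimate halves the speed within time \<open>2 \<eta> / d\<close>; iterating, the total
  time needed to come to rest is bounded by the geometric series \<open>4 \<eta> / d\<close>.\<close>
lemma strong_solution_stops:
  assumes \<gamma>: "\<gamma> \<ge> 0" and pf: "proper_fun \<phi>"
    and sol: "strong_solution F \<gamma> \<phi> x\<^sub>0 v\<^sub>0 T x v"
    and "0 \<le> s" "t \<le> T"
    and "d > 0" and d: "cball p d \<subseteq> subdifferential \<phi> 0"
    and F: "\<And>\<tau>. \<tau> \<in> {s..t} \<Longrightarrow> norm (F (x \<tau>) (v \<tau>) + p) \<le> d / 2"
    and \<eta>: "norm (v s) \<le> \<eta>" and t: "s + 4 * \<eta> / d \<le> t"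
  shows "v t = 0"
proof -
  have \<eta>0: "\<eta> \<ge> 0" using \<eta> norm_ge_zero order_trans by blast
  \<comment> \<open>The speed is at most \<open>\<eta> / 2 ^ k\<close> from time \<open>s' k\<close>
    on. These times increase towards \<open>s + 4 * \<eta> / d\<close>, which is at most
    \<open>t\<close>.\<close>
  define s' where "s' k = s + (4 * \<eta> / d) * (1 - 1 / 2 ^ k)" for k :: nat
  have d0: "4 * \<eta> / d \<ge> 0" using \<eta>0 \<open>d > 0\<close> by simp
  have s': "s \<le> s' k" "s' k \<le> t" for k
  proof -
    have "0 \<le> 1 - 1 / (2::real) ^ k" "1 - 1 / (2::real) ^ k \<le> 1" by auto
    thus "s \<le> s' k" "s' k \<le> t"
      using d0 t mult_nonneg_nonneg[OF d0, of "1 - 1 / 2 ^ k"]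
        mult_left_mono[OF _ d0, of "1 - 1 / 2 ^ k" 1]
      by (auto simp: s'_def)
  qed
  have s'_Suc: "d * (s' (Suc k) - s' k) = 2 * (\<eta> / 2 ^ k)" for k
    using \<open>d > 0\<close> by (simp add: s'_def field_simps)
  have bound: "norm (v r) \<le> \<eta> / 2 ^ k" if "s' k \<le> r" "r \<le> t" for k r
    using that
  proof (induction k arbitrary: r)
    case 0
    have "norm (v r) \<le> norm (v s)"
      by (rule strong_solution_norm_decay(1)[OF \<gamma> pf sol _ _ _ _ d F])
        (use 0 \<open>d > 0\<close> assms s'[of 0] in auto)
    with \<eta> show ?case by simp
  next
    case (Suc k)
    define e where "e = \<eta> / 2 ^ k"
    have e: "e \<ge> 0" using \<eta>0 by (simp add: e_def)
    have r: "s' k \<le> r" using s'_Suc[of k] Suc.prems e \<open>d > 0\<close>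
      by (metis e_def diff_ge_0_iff_ge order_trans zero_le_mult_iff not_le mult_nonneg_nonneg zero_le_numeral)
    have *: "norm (v (s' k)) \<le> e" unfolding e_def by (rule Suc.IH) (use s' in auto)
    have dec: "norm (v r) \<le> norm (v (s' k))"
      "(norm (v r))\<^sup>2 + d * (r - s' k) * norm (v r) \<le> (norm (v (s' k)))\<^sup>2"
      by (rule strong_solution_norm_decay[OF \<gamma> pf sol _ r _ _ d F];
          use Suc.prems \<open>d > 0\<close> assms s'[of k] in force)+
    show ?case
    \<comment> \<open>The halving argument divides by \<open>e\<close>; if \<open>e = 0\<close>, the
      speed is already zero.\<close>
    proof (cases "e = 0")
      case True
      with dec * have "norm (v r) \<le> 0" by simp
      thus ?thesis using \<eta>0 by (simp add: order_trans[of _ 0])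
    next
      case False
      \<comment> \<open>At least the \<open>k\<close>-th gap has elapsed, so the quadratic decay
        gives \<open>2 * e * norm (v r) \<le> e\<^sup>2\<close>, that is, half the previous
        bound.\<close>
      have "2 * e \<le> d * (r - s' k)"
        using s'_Suc[of k] Suc.prems(1) \<open>d > 0\<close> mult_left_mono[of "s' (Suc k) - s' k" "r - s' k" d]
        by (simp add: e_def)
      hence "2 * e * norm (v r) \<le> d * (r - s' k) * norm (v r)" by (rule mult_right_mono) simp
      also have "\<dots> \<le> (norm (v (s' k)))\<^sup>2" using dec(2) zero_le_power2[of "norm (v r)"] by linarith
      also have "\<dots> \<le> e\<^sup>2" using * by (intro power_mono) auto
      finally have "e * (2 * norm (v r)) \<le> e * e" by (simp add: power2_eq_square)
      with False e have "2 * norm (v r) \<le> e" by simp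
      thus ?thesis by (simp add: e_def)
    qed
  qed
  have "(\<lambda>k. \<eta> * (1 / 2) ^ k) \<longlonglongrightarrow> \<eta> * 0"
    by (intro tendsto_mult LIMSEQ_power_zero) auto
  hence "norm (v t) \<le> \<eta> * 0"
    by (rule LIMSEQ_le_const) (use bound s' in \<open>auto simp: power_divide\<close>)
  thus ?thesis by simp
qed

section \<open>Rest, bootstrapping and the regularised forces\<close>

text \<open>The constant selection \<open>- F a 0\<close> balances the force. Rest thereby becomes a
  solution to which others can be compared.\<close>

lemma strong_solution_constant:
  assumes "0 \<le> T" and "- F a 0 \<in> subdifferential \<phi> 0"
  shows "strong_solution F \<gamma> \<phi> a 0 T (\<lambda>_. a) (\<lambda>_. 0)"
proof -
  have L2: "L2_on T (\<lambda>_. c)" for c :: 'a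
    by (simp add: L2_on_def integrable_const_ivl)
  have "W12_deriv T (\<lambda>_. c) (\<lambda>_. 0)" for c :: 'a
    using L2[of 0] by (simp add: W12_deriv_def)
  with L2 assms show ?thesis
    unfolding strong_solution_def
    by (intro conjI exI[of _ "\<lambda>_. 0"] exI[of _ "\<lambda>_. - F a 0"]) auto
qed

text \<open>Forward uniqueness: compare with the constant solution, with \<open>m = 0\<close>. The
  data at time 0 may differ, since the comparison starts at \<open>s\<close>, where both solutions
  agree.\<close>

lemma strong_solution_rest:
  fixes x :: "real \<Rightarrow> 'a::real_inner"
  assumes "\<gamma> \<ge> 0" and "proper_fun \<phi>"
    and sol: "strong_solution F \<gamma> \<phi> x\<^sub>0 v\<^sub>0 T x v"
    and st: "0 \<le> s" "s \<le> t" "t \<le> T" and "A \<ge> 0"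
    and rest: "v s = 0" "- F (x s) 0 \<in> subdifferential \<phi> 0"
    and F: "\<And>\<tau>. \<tau> \<in> {s..t} \<Longrightarrow>
      norm (F (x \<tau>) (v \<tau>) - F (x s) 0) \<le> A * (norm (x \<tau> - x s) + norm (v \<tau>))"
  shows "x t = x s" "v t = 0"
proof -
  have "strong_solution F \<gamma> \<phi> (x s) 0 T (\<lambda>_. x s) (\<lambda>_. 0)"
    by (rule strong_solution_constant) (use st rest in auto)
  from strong_solution_compare[OF assms(1,2) sol this st \<open>A \<ge> 0\<close>, of 0] F rest
  have "(norm (x t - x s))\<^sup>2 + (norm (v t))\<^sup>2 \<le> 0" by simp
  thus "x t = x s" "v t = 0" by (auto simp: sum_power2_le_zero_iff)
qed

text \<open>If \<open>e\<close> ever exceeded \<open>b\<close>, there would be a first time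
  \<open>t2\<close> at which it equals \<open>b\<close>; up to then \<open>e\<close> is at most
  \<open>b\<close>, so the improvement step gives \<open>e t2 \<le> c < b\<close>.\<close>

lemma continuity_bootstrap:
  fixes e :: "real \<Rightarrow> real"
  assumes cont: "continuous_on {0..S} e" and "e 0 \<le> c" and "c < b"
    and step: "\<And>t. t \<in> {0..S} \<Longrightarrow> (\<And>\<tau>. \<tau> \<in> {0..t} \<Longrightarrow> e \<tau> \<le> b) \<Longrightarrow> e t \<le> c"
    and t: "t \<in> {0..S}"
  shows "e t \<le> c"
proof (rule ccontr)
  assume nt: "\<not> e t \<le> c"
  have "\<exists>\<tau>\<in>{0..t}. b < e \<tau>" using step[OF t] nt by force
  then obtain t1 where t1: "t1 \<in> {0..S}" "b < e t1" using t by force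
  define Z where "Z = {0..t1} \<inter> e -` {b..}"
  have c1: "continuous_on {0..t1} e" by (rule continuous_on_subset[OF cont]) (use t1 in auto)
  have Z: "closed Z" "t1 \<in> Z" "bdd_below Z"
    unfolding Z_def using t1
    by (auto intro: continuous_closed_preimage[OF c1] bdd_belowI)
  define t2 where "t2 = Inf Z"
  have t2: "t2 \<in> Z" unfolding t2_def using Z by (intro closed_contains_Inf) auto
  have t2_le: "t2 \<le> \<tau>" if "\<tau> \<in> Z" for \<tau>
    unfolding t2_def using that Z by (intro cInf_lower)
  have "\<exists>\<tau>\<ge>0. \<tau> \<le> t2 \<and> e \<tau> = b"
    by (rule IVT') (use t2 assms in \<open>auto simp: Z_def intro: continuous_on_subset[OF c1]\<close>)
  then obtain \<tau> where \<tau>: "0 \<le> \<tau>" "\<tau> \<le> t2" "e \<tau> = b" by blast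
  with t2_le[of \<tau>] t2 have "e t2 = b" by (auto simp: Z_def)
  have "e t2 \<le> c"
  proof (rule step)
    fix r assume r: "r \<in> {0..t2}"
    show "e r \<le> b"
    proof (cases "r = t2")
      case False
      with r t2_le[of r] have "r \<notin> Z" by auto
      thus ?thesis using r t2 by (auto simp: Z_def)
    qed (use \<open>e t2 = b\<close> in simp)
  qed (use t2 t1 in \<open>auto simp: Z_def\<close>)
  with \<open>e t2 = b\<close> \<open>c < b\<close> show False by simp
qed

text \<open>Converts the comparison estimate for squares into a bound for the sum of the norms that
  is linear in the force error \<open>m\<close>.\<close>

lemma add_le_of_sum_squares_le:
  fixes a b m Q :: real
  assumes "a\<^sup>2 + b\<^sup>2 \<le> m\<^sup>2 * Q" and "0 \<le> m"
  shows "a + b \<le> m * sqrt (2 * Q)"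
proof -
  have "(a + b)\<^sup>2 \<le> 2 * (a\<^sup>2 + b\<^sup>2)"
    using sum_squares_bound[of a b] by (simp add: power2_sum)
  also have "\<dots> \<le> m\<^sup>2 * (2 * Q)" using assms by simp
  finally have "a + b \<le> sqrt (m\<^sup>2 * (2 * Q))" by (rule real_le_rsqrt)
  thus ?thesis using \<open>0 \<le> m\<close> by (simp add: real_sqrt_mult)
qed

section \<open>Bounds for the regularised forces\<close>

text \<open>What both regularised forces share: on bounded sets they are Lipschitz perturbations of
  the gradient, with an error of order \<open>\<beta>\<close> that vanishes at zero velocity. One
  argument thus covers both systems.\<close>

definition force_bound ::
  "('a::real_normed_vector \<Rightarrow> 'a) \<Rightarrow> real \<Rightarrow> real \<Rightarrow> real \<Rightarrow> ('a \<Rightarrow> 'a \<Rightarrow> 'a) \<Rightarrow> bool" where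
  "force_bound g R B \<beta> F \<longleftrightarrow> (\<forall>x v x'. norm x \<le> R \<longrightarrow> norm v \<le> R \<longrightarrow> norm x' \<le> R \<longrightarrow>
     norm (F x v - g x') \<le> B * (norm (x - x') + \<beta> * norm v))"

lemma force_boundD:
  "force_bound g R B \<beta> F \<Longrightarrow> norm x \<le> R \<Longrightarrow> norm v \<le> R \<Longrightarrow> norm x' \<le> R \<Longrightarrow>
     norm (F x v - g x') \<le> B * (norm (x - x') + \<beta> * norm v)"
  by (auto simp: force_bound_def)

text \<open>The constant is \<open>L + K\<close>, a Lipschitz constant of \<open>g\<close> plus a
  bound for \<open>H\<close>. Both are taken on a ball large enough to contain
  \<open>x + \<beta> *\<^sub>R v\<close> for every \<open>\<beta> \<le> \<beta>max\<close>, hence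
  uniform in \<open>\<beta>\<close>.\<close>

lemma ex_force_bound:
  fixes g :: "'a::real_normed_vector \<Rightarrow> 'a"
  assumes "lipschitz_on_bounded g" and "bounded_on_bounded H" and "\<beta>max \<ge> 0"
  shows "\<exists>B\<ge>0. \<forall>\<beta>. 0 \<le> \<beta> \<longrightarrow> \<beta> \<le> \<beta>max \<longrightarrow>
    force_bound g R B \<beta> (implicit_force g \<beta>) \<and> force_bound g R B \<beta> (explicit_force g H \<beta>)"
proof -
  let ?U = "cball 0 ((1 + \<beta>max) * R)"
  obtain L where L: "L-lipschitz_on ?U g"
    using assms(1) bounded_cball unfolding lipschitz_on_bounded_def by blast
  have "bounded (H ` ?U)"
    using assms(2) bounded_cball unfolding bounded_on_bounded_def by blast
  then obtain K where K: "K > 0" "\<And>x. x \<in> ?U \<Longrightarrow> norm (H x) \<le> K"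
    unfolding bounded_pos by blast
  have L0: "L \<ge> 0" by (rule lipschitz_on_nonneg[OF L])
  have lip: "norm (g a - g b) \<le> L * norm (a - b)" if "a \<in> ?U" "b \<in> ?U" for a b
    using lipschitz_onD[OF L that] by (simp add: dist_norm)
  have "force_bound g R (L + K) \<beta> (implicit_force g \<beta>) \<and> force_bound g R (L + K) \<beta> (explicit_force g H \<beta>)"
    if \<beta>: "0 \<le> \<beta>" "\<beta> \<le> \<beta>max" for \<beta>
    unfolding force_bound_def
  proof (intro conjI allI impI)
    fix x v x' :: 'a assume R: "norm x \<le> R" "norm v \<le> R" "norm x' \<le> R"
    have R0: "0 \<le> \<beta>max * R"
      using assms(3) order_trans[OF norm_ge_zero R(1)] by simp
    have U: "x \<in> ?U" "x' \<in> ?U" using R R0 by (auto simp: algebra_simps)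
    have bv: "norm (\<beta> *\<^sub>R v) = \<beta> * norm v" using \<beta> by simp
    have "norm (\<beta> *\<^sub>R v) \<le> \<beta>max * R" unfolding bv using \<beta> R by (intro mult_mono) auto
    hence "norm (x + \<beta> *\<^sub>R v) \<le> R + \<beta>max * R" using R(1) by (intro norm_triangle_le add_mono)
    hence U': "x + \<beta> *\<^sub>R v \<in> ?U" by (simp add: algebra_simps)
    have nn: "0 \<le> norm (x - x')" "0 \<le> \<beta> * norm v" using \<beta> by auto
    have "norm (g (x + \<beta> *\<^sub>R v) - g x') \<le> L * norm (x - x' + \<beta> *\<^sub>R v)"
      using lip[OF U' U(2)] by (simp add: algebra_simps)
    also have "\<dots> \<le> L * (norm (x - x') + \<beta> * norm v)"
      using norm_triangle_ineq[of "x - x'" "\<beta> *\<^sub>R v"] bv L0 by (intro mult_left_mono) auto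
    also have "\<dots> \<le> (L + K) * (norm (x - x') + \<beta> * norm v)"
      using K(1) nn by (intro mult_right_mono) auto
    finally show "norm (implicit_force g \<beta> x v - g x') \<le> (L + K) * (norm (x - x') + \<beta> * norm v)"
      by (simp add: implicit_force_def)
    have "norm (explicit_force g H \<beta> x v - g x') \<le> norm (g x - g x') + norm (\<beta> *\<^sub>R blinfun_apply (H x) v)"
      unfolding explicit_force_def using norm_triangle_ineq[of "g x - g x'" "\<beta> *\<^sub>R blinfun_apply (H x) v"]
      by (simp add: algebra_simps)
    also have "\<dots> \<le> L * norm (x - x') + \<beta> * (K * norm v)"
    proof (intro add_mono lip U)
      have "norm (blinfun_apply (H x) v) \<le> K * norm v"
        using norm_blinfun[of "H x" v] mult_right_mono[OF K(2)[OF U(1)], of "norm v"] by simp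
      thus "norm (\<beta> *\<^sub>R blinfun_apply (H x) v) \<le> \<beta> * (K * norm v)"
        using \<beta> by (simp add: mult_left_mono)
    qed
    also have "\<dots> \<le> (L + K) * (norm (x - x') + \<beta> * norm v)"
      using mult_nonneg_nonneg[OF less_imp_le[OF K(1)] nn(1)] mult_nonneg_nonneg[OF L0 nn(2)]
      by (simp add: algebra_simps)
    finally show "norm (explicit_force g H \<beta> x v - g x') \<le> (L + K) * (norm (x - x') + \<beta> * norm v)" .
  qed
  thus ?thesis using L0 K(1) by (intro exI[of _ "L + K"]) auto
qed

text \<open>Mean value inequality on the segment from \<open>x\<close> to \<open>x + h\<close>,
  where the derivative of \<open>g\<close> differs from \<open>H x\<close> by at most
  \<open>M * norm h\<close>.\<close>

lemma gradient_linearization_bound: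
  assumes C2: "C2_with f g H" and lip: "M-lipschitz_on (cball 0 \<rho>) H"
    and x: "norm x \<le> \<rho>" and xh: "norm (x + h) \<le> \<rho>"
  shows "norm (g (x + h) - g x - blinfun_apply (H x) h) \<le> M * (norm h)\<^sup>2"
proof -
  have "norm (g (x + h) - g x - blinfun_apply (H x) (x + h - x)) \<le> norm (x + h - x) * (M * norm h)"
  proof (rule differentiable_bound_linearization[where f' = "\<lambda>z. blinfun_apply (H z)" and ?x0.0 = x])
    let ?S = "closed_segment x (x + h)"
    show "x + t *\<^sub>R (x + h - x) \<in> ?S" if "t \<in> {0..1}" for t :: real
      using that by (auto simp: in_segment algebra_simps intro!: exI[of _ t])
    show "(g has_derivative blinfun_apply (H z)) (at z within ?S)" for z
      using C2 by (auto simp: C2_with_def intro: has_derivative_at_withinI)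
    show "onorm (blinfun_apply (H z) - blinfun_apply (H x)) \<le> M * norm h" if z: "z \<in> ?S" for z
    proof -
      have "?S \<subseteq> cball 0 \<rho>" using x xh by (intro closed_segment_subset) auto
      hence "norm (H z - H x) \<le> M * norm (z - x)"
        using lipschitz_onD[OF lip, of z x] z x by (auto simp: dist_norm)
      also have "\<dots> \<le> M * norm h"
        using segment_bound1[OF z] lipschitz_on_nonneg[OF lip] by (intro mult_left_mono) auto
      finally show ?thesis
        by (simp add: norm_blinfun.rep_eq blinfun.diff_left[abs_def] fun_diff_def)
    qed
  qed auto
  thus ?thesis by (simp add: power2_eq_square mult_ac)
qed

text \<open>At the same state the forces differ by the Taylor remainder of \<open>g\<close>, of
  order \<open>\<beta>\<^sup>2\<close>. Changing the state costs Lipschitz terms from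
  \<open>g\<close>, from \<open>H\<close> at a fixed velocity, and from \<open>H x'\<close> applied
  to \<open>v - v'\<close>.\<close>

lemma implicit_explicit_force_diff:
  fixes g :: "'a::real_inner \<Rightarrow> 'a"
  assumes C2: "C2_with f g H" and "lipschitz_on_bounded g" and "bounded_on_bounded H"
    and "lipschitz_on_bounded H" and "\<beta>max \<ge> 0"
  shows "\<exists>A\<ge>0. \<forall>\<beta> x v x' v'. 0 \<le> \<beta> \<longrightarrow> \<beta> \<le> \<beta>max \<longrightarrow>
    norm x \<le> R \<longrightarrow> norm v \<le> R \<longrightarrow> norm x' \<le> R \<longrightarrow> norm v' \<le> R \<longrightarrow>
    norm (implicit_force g \<beta> x v - explicit_force g H \<beta> x' v')
      \<le> A * (norm (x - x') + norm (v - v')) + A * \<beta>\<^sup>2"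
proof -
  let ?U = "cball 0 ((1 + \<beta>max) * R)"
  obtain L where L: "L-lipschitz_on ?U g"
    using assms(2) bounded_cball unfolding lipschitz_on_bounded_def by blast
  obtain M where M: "M-lipschitz_on ?U H"
    using assms(4) bounded_cball unfolding lipschitz_on_bounded_def by blast
  have "bounded (H ` ?U)"
    using assms(3) bounded_cball unfolding bounded_on_bounded_def by blast
  then obtain K where K: "K > 0" "\<And>x. x \<in> ?U \<Longrightarrow> norm (H x) \<le> K"
    unfolding bounded_pos by blast
  have L0: "L \<ge> 0" and M0: "M \<ge> 0" by (rule lipschitz_on_nonneg[OF L], rule lipschitz_on_nonneg[OF M])
  \<comment> \<open>Collects all coefficients, so that \<open>A\<close> serves in both terms. The
    absolute value keeps it nonnegative for negative \<open>R\<close>, when the estimate is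
    vacuous.\<close>
  define A where "A = L + \<beta>max * M * \<bar>R\<bar> + \<beta>max * K + M * R\<^sup>2"
  have A0: "A \<ge> 0" using L0 M0 K(1) assms(5) by (simp add: A_def)
  have "norm (implicit_force g \<beta> x v - explicit_force g H \<beta> x' v')
      \<le> A * (norm (x - x') + norm (v - v')) + A * \<beta>\<^sup>2"
    if \<beta>: "0 \<le> \<beta>" "\<beta> \<le> \<beta>max"
      and R: "norm x \<le> R" "norm v \<le> R" "norm x' \<le> R" "norm v' \<le> R" for \<beta> and x v x' v' :: 'a
  proof -
    have Rp: "R \<ge> 0" using order_trans[OF norm_ge_zero R(1)] .
    hence R0: "0 \<le> \<beta>max * R" using assms(5) by simp
    have U: "x \<in> ?U" "x' \<in> ?U" using R R0 by (auto simp: algebra_simps)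
    have bv: "norm (\<beta> *\<^sub>R v) = \<beta> * norm v" using \<beta> by simp
    have "norm (\<beta> *\<^sub>R v) \<le> \<beta>max * R" unfolding bv using \<beta> R by (intro mult_mono) auto
    hence "norm (x + \<beta> *\<^sub>R v) \<le> R + \<beta>max * R" using R(1) by (intro norm_triangle_le add_mono)
    hence U': "x + \<beta> *\<^sub>R v \<in> ?U" by (simp add: algebra_simps)
    have 1: "norm (g (x + \<beta> *\<^sub>R v) - g x - \<beta> *\<^sub>R blinfun_apply (H x) v) \<le> M * R\<^sup>2 * \<beta>\<^sup>2"
    proof -
      have "norm (g (x + \<beta> *\<^sub>R v) - g x - blinfun_apply (H x) (\<beta> *\<^sub>R v)) \<le> M * (norm (\<beta> *\<^sub>R v))\<^sup>2"
        by (rule gradient_linearization_bound[OF C2 M]) (use U U' in auto)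
      also have "\<dots> \<le> M * (\<beta> * R)\<^sup>2"
        using R \<beta> M0 unfolding bv by (intro mult_left_mono power_mono) auto
      finally show ?thesis by (simp add: blinfun.scaleR_right power_mult_distrib mult_ac)
    qed
    have 2: "norm (g x - g x') \<le> L * norm (x - x')"
      using lipschitz_onD[OF L U] by (simp add: dist_norm)
    have 3: "norm (\<beta> *\<^sub>R blinfun_apply (H x - H x') v) \<le> \<beta>max * M * R * norm (x - x')"
    proof -
      have "norm (blinfun_apply (H x - H x') v) \<le> (M * norm (x - x')) * R"
        using norm_blinfun[of "H x - H x'" v] lipschitz_onD[OF M U] R M0
          mult_mono[of "norm (H x - H x')" "M * norm (x - x')" "norm v" R]
        by (simp add: dist_norm)
      hence "\<beta> * norm (blinfun_apply (H x - H x') v) \<le> \<beta>max * ((M * norm (x - x')) * R)"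
        using \<beta> by (intro mult_mono) auto
      thus ?thesis using \<beta> by (simp add: mult_ac)
    qed
    have 4: "norm (\<beta> *\<^sub>R blinfun_apply (H x') (v - v')) \<le> \<beta>max * K * norm (v - v')"
    proof -
      have "norm (blinfun_apply (H x') (v - v')) \<le> K * norm (v - v')"
        using norm_blinfun[of "H x'" "v - v'"] mult_right_mono[OF K(2)[OF U(2)], of "norm (v - v')"] by simp
      hence "\<beta> * norm (blinfun_apply (H x') (v - v')) \<le> \<beta>max * (K * norm (v - v'))"
        using \<beta> by (intro mult_mono) auto
      thus ?thesis using \<beta> by (simp add: mult_ac)
    qed
    have "implicit_force g \<beta> x v - explicit_force g H \<beta> x' v'
      = (g (x + \<beta> *\<^sub>R v) - g x - \<beta> *\<^sub>R blinfun_apply (H x) v) + ((g x - g x')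
        + (\<beta> *\<^sub>R blinfun_apply (H x - H x') v + \<beta> *\<^sub>R blinfun_apply (H x') (v - v')))"
      by (simp add: implicit_force_def explicit_force_def blinfun.diff_left blinfun.diff_right algebra_simps)
    also have "norm \<dots> \<le>
       M * R\<^sup>2 * \<beta>\<^sup>2 + (L * norm (x - x') + (\<beta>max * M * R * norm (x - x') + \<beta>max * K * norm (v - v')))"
      by (intro norm_triangle_le add_mono 1 2 3 4)
    also have "\<dots> = (L + \<beta>max * M * R) * norm (x - x') + \<beta>max * K * norm (v - v') + M * R\<^sup>2 * \<beta>\<^sup>2"
      by (simp add: algebra_simps)
    also have "\<dots> \<le> A * norm (x - x') + A * norm (v - v') + A * \<beta>\<^sup>2"
      using L0 M0 K(1) assms(5) Rp
      by (intro add_mono mult_right_mono) (auto simp: A_def)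
    finally show ?thesis by (simp add: algebra_simps)
  qed
  with A0 show ?thesis by blast
qed

section \<open>Stopping times\<close>

text \<open>Bootstrap: while the squared distance \<open>e\<close> is at most 1, the trajectory
  stays in the ball of radius \<open>R + 1\<close>, so \<open>force_bound\<close> applies with error
  \<open>m\<close>. The comparison then returns \<open>e r \<le> m\<^sup>2 * Q\<close>, which is
  below 1.\<close>

lemma near_reference:
  fixes x xz :: "real \<Rightarrow> 'a::real_inner"
  assumes "\<gamma> \<ge> 0" and "proper_fun \<phi>"
    and sol: "strong_solution F \<gamma> \<phi> a b S x v"
    and ref: "strong_solution (\<lambda>x v. g x) \<gamma> \<phi> a b S xz vz"
    and F: "force_bound g (R + 1) B \<beta> F" and "B \<ge> 0" "\<beta> \<ge> 0" "R \<ge> 0"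
    and R: "\<And>t. t \<in> {0..S} \<Longrightarrow> norm (xz t) \<le> R \<and> norm (vz t) \<le> R"
    and D: "D = sqrt (2 * (S * exp ((2 + 3 * B) * S)))"
    and small: "B * (R + 1) * D * \<beta> \<le> 1 / 2"
    and t: "t \<in> {0..S}"
  shows "norm (x t - xz t) + norm (v t - vz t) \<le> B * (R + 1) * D * \<beta>"
    and "norm (x t) \<le> R + 1" and "norm (v t) \<le> R + 1"
proof -
  define m Q e where "m = B * \<beta> * (R + 1)" and "Q = S * exp ((2 + 3 * B) * S)"
    and "e r = (norm (x r - xz r))\<^sup>2 + (norm (v r - vz r))\<^sup>2" for r
  have S: "S \<ge> 0" using t by auto
  have m: "m \<ge> 0" using assms by (simp add: m_def)
  have Q: "Q \<ge> 0" using S by (simp add: Q_def)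
  have D': "D = sqrt (2 * Q)" by (simp add: D Q_def)
  \<comment> \<open>Since \<open>D\<^sup>2 = 2 * Q\<close>, the smallness of \<open>m * D\<close>
    gives \<open>m\<^sup>2 * Q \<le> 1 / 8\<close>.\<close>
  have "m * D \<le> 1 / 2" using small by (simp add: m_def mult_ac)
  hence "(m * D)\<^sup>2 \<le> (1 / 2)\<^sup>2" using m by (intro power_mono) (auto simp: D' Q)
  hence c1: "m\<^sup>2 * Q < 1" using Q by (simp add: D' power_mult_distrib power_divide)
  have within: "norm (x r) \<le> R + 1 \<and> norm (v r) \<le> R + 1" if "r \<in> {0..S}" "e r \<le> 1" for r
  proof -
    have "(norm (x r - xz r))\<^sup>2 \<le> 1" "(norm (v r - vz r))\<^sup>2 \<le> 1"
      using that(2) zero_le_power2[of "norm (x r - xz r)"] zero_le_power2[of "norm (v r - vz r)"]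
      unfolding e_def by linarith+
    hence "norm (x r - xz r) \<le> 1" "norm (v r - vz r) \<le> 1"
      by (auto simp: power_le_one_iff abs_square_le_1[symmetric])
    thus ?thesis
      using R[OF that(1)] norm_triangle_ineq2[of "x r" "xz r"] norm_triangle_ineq2[of "v r" "vz r"] by linarith
  qed
  have bound: "e r \<le> m\<^sup>2 * Q" if "r \<in> {0..S}" for r
  proof (rule continuity_bootstrap[of S e _ 1, OF _ _ c1 _ that])
    show "continuous_on {0..S} e"
      unfolding e_def
      by (intro continuous_intros strong_solution_continuous_on[OF sol] strong_solution_continuous_on[OF ref])
    show "e 0 \<le> m\<^sup>2 * Q"
      using sol ref Q by (simp add: e_def strong_solution_def)
    fix r assume r: "r \<in> {0..S}" and le: "\<And>\<tau>. \<tau> \<in> {0..r} \<Longrightarrow> e \<tau> \<le> 1"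
    have F': "norm (F (x \<tau>) (v \<tau>) - g (xz \<tau>)) \<le> B * (norm (x \<tau> - xz \<tau>) + norm (v \<tau> - vz \<tau>)) + m"
      if \<tau>: "\<tau> \<in> {0..r}" for \<tau>
    proof -
      have \<tau>S: "\<tau> \<in> {0..S}" using \<tau> r by auto
      note w = within[OF \<tau>S le[OF \<tau>]]
      have "norm (F (x \<tau>) (v \<tau>) - g (xz \<tau>)) \<le> B * (norm (x \<tau> - xz \<tau>) + \<beta> * norm (v \<tau>))"
        by (rule force_boundD[OF F]) (use w R[OF \<tau>S] in auto)
      also have "\<dots> \<le> B * ((norm (x \<tau> - xz \<tau>) + norm (v \<tau> - vz \<tau>)) + \<beta> * (R + 1))"
        using w \<open>B \<ge> 0\<close> \<open>\<beta> \<ge> 0\<close> by (intro mult_left_mono add_mono) auto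
      finally show ?thesis by (simp add: m_def algebra_simps)
    qed
    have "e r \<le> (e 0 + m\<^sup>2 * (r - 0)) * exp ((2 + 3 * B) * (r - 0))"
      unfolding e_def
      by (rule strong_solution_compare[OF assms(1,2) sol ref _ _ _ \<open>B \<ge> 0\<close>]) (use F' r in auto)
    also have "\<dots> = m\<^sup>2 * (r * exp ((2 + 3 * B) * r))"
      using sol ref by (simp add: e_def strong_solution_def)
    also have "\<dots> \<le> m\<^sup>2 * Q"
      unfolding Q_def using r \<open>B \<ge> 0\<close>
      by (intro mult_left_mono mult_mono iffD2[OF exp_le_cancel_iff]) auto
    finally show "e r \<le> m\<^sup>2 * Q" .
  qed
  from within[OF t] bound[OF t] c1 show "norm (x t) \<le> R + 1" "norm (v t) \<le> R + 1" by auto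
  have "norm (x t - xz t) + norm (v t - vz t) \<le> m * sqrt (2 * Q)"
    by (rule add_le_of_sum_squares_le) (use bound[OF t] m in \<open>auto simp: e_def\<close>)
  thus "norm (x t - xz t) + norm (v t - vz t) \<le> B * (R + 1) * D * \<beta>"
    by (simp add: m_def D' mult_ac)
qed

section \<open>Permanent stopping times and permanent rest\<close>

lemma stopping_time_le:
  assumes "0 \<le> s" and "\<And>t. s \<le> t \<Longrightarrow> v t = 0"
  shows "stopping_time v \<le> ereal s"
  unfolding stopping_time_def using assms by (intro Inf_lower) auto

lemma stopping_time_nonneg: "0 \<le> stopping_time v"
  unfolding stopping_time_def by (intro Inf_greatest) auto

text \<open>The infimum is attained: \<open>v\<close> vanishes after \<open>T\<close>, and
  continuity from the right gives \<open>v T = 0\<close>.\<close>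

lemma stopping_time_rest:
  fixes v :: "real \<Rightarrow> 'a::real_normed_vector"
  assumes cont: "\<And>S. S > 0 \<Longrightarrow> continuous_on {0..S} v"
    and T: "stopping_time v = ereal T" and "T \<le> t"
  shows "v t = 0"
proof -
  have T0: "0 \<le> T" using stopping_time_nonneg[of v] T by simp
  have later: "v r = 0" if "T < r" for r
  proof -
    have "stopping_time v < ereal r" using T that by simp
    then obtain s where "s < r" "\<forall>t\<ge>s. v t = 0"
      unfolding stopping_time_def by (auto simp: Inf_less_iff)
    thus ?thesis by auto
  qed
  show ?thesis
  proof (cases "t = T")
    case True
    have "continuous_on {0..T + 1} v" using T0 by (intro cont) auto
    hence "continuous_on {T..T + 1} v" by (rule continuous_on_subset) (use T0 in auto)
    hence "(v \<longlongrightarrow> v T) (at T within {T..T + 1})"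
      by (auto simp: continuous_on_def)
    hence "(v \<longlongrightarrow> v T) (at_right T)"
      by (simp add: at_within_Icc_at_right)
    moreover have "(v \<longlongrightarrow> 0) (at_right T)"
      by (rule tendsto_eventually) (auto simp: eventually_at_right_less later intro: eventually_mono[OF eventually_at_right_less])
    ultimately have "v T = 0" by (intro tendsto_unique[of "at_right T"]) auto
    with True show ?thesis by simp
  qed (use later \<open>T \<le> t\<close> in auto)
qed

text \<open>Used when another trajectory has stopped at time \<open>s\<close>; then
  \<open>\<eta>\<close> is a bound for the velocity difference, hence for the remaining
  speed.\<close>

lemma stopping_time_le_add:
  assumes "\<gamma> \<ge> 0" and "proper_fun \<phi>"
    and sol: "strong_solution F \<gamma> \<phi> a b S x v" and "0 \<le> s"
    and "d > 0" and d: "cball p d \<subseteq> subdifferential \<phi> 0"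
    and F: "\<And>\<tau>. \<tau> \<in> {s..S} \<Longrightarrow> norm (F (x \<tau>) (v \<tau>) + p) \<le> d / 2"
    and \<eta>: "norm (v s) \<le> \<eta>" and rest: "\<And>t. t \<ge> S \<Longrightarrow> v t = 0"
  shows "stopping_time v \<le> ereal (s + 4 * \<eta> / d)"
proof (rule stopping_time_le)
  have "0 \<le> 4 * \<eta> / d" using \<open>d > 0\<close> order_trans[OF norm_ge_zero \<eta>] by simp
  thus "0 \<le> s + 4 * \<eta> / d" using \<open>0 \<le> s\<close> by simp
  fix t assume t: "s + 4 * \<eta> / d \<le> t"
  show "v t = 0"
  proof (cases "t \<le> S")
    case True
    show ?thesis
      by (rule strong_solution_stops[OF assms(1,2) sol \<open>0 \<le> s\<close> True \<open>d > 0\<close> d _ \<eta> t]) (use F True in auto)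
  qed (use rest in auto)
qed

text \<open>On each finite horizon the curves are bounded, so \<open>force_bound\<close> supplies
  the Lipschitz estimate around the rest point that forward uniqueness requires.\<close>

lemma global_strong_solution_rest:
  fixes x :: "real \<Rightarrow> 'a::real_inner"
  assumes "\<gamma> \<ge> 0" and "proper_fun \<phi>"
    and sol: "global_strong_solution F \<gamma> \<phi> a b x v"
    and F0: "\<And>x. F x 0 = g x" and F: "\<And>R. \<exists>B\<ge>0. force_bound g R B \<beta> F" and "0 \<le> \<beta>"
    and s: "0 \<le> s" "v s = 0" "- g (x s) \<in> subdifferential \<phi> 0" and t: "s \<le> t"
  shows "x t = x s" "v t = 0"
proof -
  have sol': "strong_solution F \<gamma> \<phi> a b (t + 1) x v"
    using sol s t by (simp add: global_strong_solution_def)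
  have "bounded (x ` {0..t + 1})" "bounded (v ` {0..t + 1})"
    by (intro compact_imp_bounded compact_continuous_image strong_solution_continuous_on[OF sol']; simp)+
  then obtain R1 R2 where R: "\<And>r. r \<in> {0..t + 1} \<Longrightarrow> norm (x r) \<le> R1"
    "\<And>r. r \<in> {0..t + 1} \<Longrightarrow> norm (v r) \<le> R2"
    unfolding bounded_iff by (metis imageI)
  obtain B where B: "B \<ge> 0" "force_bound g (max R1 R2) B \<beta> F" using F by blast
  have "norm (F (x \<tau>) (v \<tau>) - F (x s) 0) \<le> (B * (1 + \<beta>)) * (norm (x \<tau> - x s) + norm (v \<tau>))"
    if \<tau>: "\<tau> \<in> {s..t}" for \<tau>
  proof -
    have "norm (F (x \<tau>) (v \<tau>) - g (x s)) \<le> B * (norm (x \<tau> - x s) + \<beta> * norm (v \<tau>))"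
      by (rule force_boundD[OF B(2)]) (use R(1)[of \<tau>] R(2)[of \<tau>] R(1)[of s] \<tau> s t in auto)
    also have "\<dots> \<le> B * ((1 + \<beta>) * (norm (x \<tau> - x s) + norm (v \<tau>)))"
      using \<open>0 \<le> \<beta>\<close> B(1) by (intro mult_left_mono) (auto simp: algebra_simps)
    finally show ?thesis by (simp add: F0 mult_ac)
  qed
  note * = strong_solution_rest[OF assms(1,2) sol' s(1) t _ _ s(2) _ this]
  show "x t = x s" "v t = 0" by (rule *; use s B \<open>0 \<le> \<beta>\<close> in \<open>simp add: F0\<close>)+
qed

lemma strong_solution_fixed:
  assumes sol: "strong_solution F \<gamma> \<phi> a b S x v" and st: "0 \<le> s" "s \<le> t" "t \<le> S"
    and rest: "\<And>\<tau>. \<tau> \<in> {s..t} \<Longrightarrow> v \<tau> = 0"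
  shows "x t = x s"
  using strong_solution_displacement_le[OF sol st, of 0] rest by simp

section \<open>Stopping of one regularised trajectory near the reference stopping time\<close>

text \<open>The velocities differ by at most \<open>c * \<beta>\<close>. At \<open>T0\<close> the
  reference rests, so the perturbed trajectory stops within a further time
  \<open>h = 4 * (c * \<beta>) / \<delta>\<close>; exchanging roles at \<open>T\<close> gives
  \<open>T0 \<le> T + h\<close>. The last conclusion provides the friction margin for comparing the
  two regularised systems.\<close>

lemma perturbed_solution_stops:
  fixes x xz :: "real \<Rightarrow> 'a::real_inner"
  assumes \<gamma>: "\<gamma> \<ge> 0" and pf: "proper_fun \<phi>"
    and ref: "global_strong_solution (\<lambda>x v. g x) \<gamma> \<phi> a b xz vz"
    and T0: "stopping_time vz = ereal T0"
    and "\<delta> > 0" and \<delta>: "cball (- g (xz T0)) \<delta> \<subseteq> subdifferential \<phi> 0"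
    and R: "\<And>t. t \<in> {0..T0 + 1} \<Longrightarrow> norm (xz t) \<le> R \<and> norm (vz t) \<le> R"
    and "B \<ge> 0" and D: "D = sqrt (2 * ((T0 + 1) * exp ((2 + 3 * B) * (T0 + 1))))"
    and c: "c = B * (R + 1) * D"
    and sol: "global_strong_solution F \<gamma> \<phi> a b x v"
    and F0: "\<And>x. F x 0 = g x" and FB: "force_bound g (R + 1) B \<beta> F"
    and F: "\<And>R. \<exists>B\<ge>0. force_bound g R B \<beta> F" and "0 \<le> \<beta>"
    and small: "(c + 4 * c / \<delta> + B * (c + R * (4 * c / \<delta>) + (R + 1)) + B * (c * T0)) * \<beta>
      \<le> min (1 / 2) (\<delta> / 2)"
  obtains T where "stopping_time v = ereal T" "0 \<le> T" "T \<le> T0 + 1" "\<bar>T - T0\<bar> \<le> 4 * c / \<delta> * \<beta>"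
    "\<And>t. T \<le> t \<Longrightarrow> v t = 0" "\<And>t. T \<le> t \<Longrightarrow> x t = x (T0 + 1)"
    "\<And>t. t \<in> {0..T0 + 1} \<Longrightarrow> norm (x t) \<le> R + 1 \<and> norm (v t) \<le> R + 1"
    "\<And>t. t \<in> {0..T0 + 1} \<Longrightarrow> T0 - 4 * c / \<delta> * \<beta> \<le> t \<Longrightarrow>
       norm (F (x t) (v t) + (- g (xz T0))) \<le> \<delta> / 2"
proof -
  define S h where "S = T0 + 1" and "h = 4 * (c * \<beta>) / \<delta>"
  have T0_nonneg: "T0 \<ge> 0" using stopping_time_nonneg[of vz] T0 by simp
  have S: "S > 0" using T0_nonneg by (simp add: S_def)
  have R0: "R \<ge> 0" using R[of 0] T0_nonneg order_trans[OF norm_ge_zero] by auto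
  have D0: "D \<ge> 0" using T0_nonneg by (simp add: D)
  have c0: "c \<ge> 0" using R0 D0 \<open>B \<ge> 0\<close> by (simp add: c)
  have cb: "c * \<beta> \<ge> 0" and h0: "h \<ge> 0" using c0 \<open>0 \<le> \<beta>\<close> \<open>\<delta> > 0\<close> by (auto simp: h_def)
  have "c * \<beta> + h + B * (c * \<beta> + R * h + \<beta> * (R + 1)) + B * (c * \<beta> * T0) \<le> min (1 / 2) (\<delta> / 2)"
    using small by (simp add: h_def algebra_simps)
  moreover have "B * (c * \<beta> + R * h + \<beta> * (R + 1)) \<ge> 0" "B * (c * \<beta> * T0) \<ge> 0"
    using cb h0 R0 T0_nonneg \<open>B \<ge> 0\<close> \<open>0 \<le> \<beta>\<close> by auto
  \<comment> \<open>The four bounds serve, in turn, the closeness to the reference, the inequality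
    \<open>T0 + h \<le> S\<close>, the friction margin of the perturbed trajectory, and that of the
    reference after \<open>T\<close>.\<close>
  ultimately have s1: "c * \<beta> \<le> 1 / 2" and s2: "h \<le> 1"
    and s3: "B * (c * \<beta> + R * h + \<beta> * (R + 1)) \<le> \<delta> / 2" and s4: "B * (c * \<beta> * T0) \<le> \<delta> / 2"
    using cb h0 by (auto simp: min_def split: if_splits)
  have sols: "strong_solution F \<gamma> \<phi> a b r x v" "strong_solution (\<lambda>x v. g x) \<gamma> \<phi> a b r xz vz"
    if "r > 0" for r
    using sol ref that by (auto simp: global_strong_solution_def)
  note near = near_reference[OF \<gamma> pf sols[OF S] FB \<open>B \<ge> 0\<close> \<open>0 \<le> \<beta>\<close> R0 R, unfolded S_def, OF _ D,
      folded c, OF _ s1]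
  have near1: "norm (x t - xz t) \<le> c * \<beta>" "norm (v t - vz t) \<le> c * \<beta>"
    and within: "norm (x t) \<le> R + 1" "norm (v t) \<le> R + 1" if t: "t \<in> {0..S}" for t
  proof -
    have t': "t \<in> {0..T0 + 1}" using t by (simp add: S_def)
    show "norm (x t - xz t) \<le> c * \<beta>" "norm (v t - vz t) \<le> c * \<beta>"
      using near(1)[OF _ t'] norm_ge_zero[of "x t - xz t"] norm_ge_zero[of "v t - vz t"] by linarith+
    show "norm (x t) \<le> R + 1" "norm (v t) \<le> R + 1"
      using near(2,3)[OF _ t'] by auto
  qed
  have vz: "vz t = 0" if "T0 \<le> t" for t
    by (rule stopping_time_rest[OF _ T0 that]) (rule strong_solution_continuous_on[OF sols(2)])
  have xz: "xz t = xz T0" if "T0 \<le> t" for t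
    by (rule strong_solution_fixed[OF sols(2)[of "t + 1"] T0_nonneg that])
      (use vz T0_nonneg that in auto)
  \<comment> \<open>The margin must reach back to \<open>T0 - h\<close>, since a regularised
    trajectory may stop that early. Over this time the reference moves by at most
    \<open>R * h\<close>.\<close>
  have close: "norm (F (x t) (v t) + (- g (xz T0))) \<le> \<delta> / 2" if t: "t \<in> {0..S}" "T0 - h \<le> t" for t
  proof -
    have "norm (xz t - xz T0) \<le> R * h"
    proof (cases "T0 \<le> t")
      case False
      have "norm (xz T0 - xz t) \<le> R * (T0 - t)"
        by (rule strong_solution_displacement_le[OF sols(2)[OF S]]) (use False t R in \<open>auto simp: S_def\<close>)
      also have "\<dots> \<le> R * h" using t R0 by (intro mult_left_mono) auto
      finally show ?thesis by (simp add: norm_minus_commute)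
    qed (use xz[of t] h0 R0 in simp)
    hence "norm (x t - xz T0) \<le> c * \<beta> + R * h"
      using near1(1)[OF t(1)] norm_triangle_ineq[of "x t - xz t" "xz t - xz T0"] by simp
    moreover have "\<beta> * norm (v t) \<le> \<beta> * (R + 1)"
      using within[OF t(1)] \<open>0 \<le> \<beta>\<close> by (intro mult_left_mono)
    ultimately have "B * (norm (x t - xz T0) + \<beta> * norm (v t)) \<le> B * (c * \<beta> + R * h + \<beta> * (R + 1))"
      using \<open>B \<ge> 0\<close> by (intro mult_left_mono[OF add_mono])
    moreover have "norm (F (x t) (v t) - g (xz T0)) \<le> B * (norm (x t - xz T0) + \<beta> * norm (v t))"
      by (rule force_boundD[OF FB]) (use within[OF t(1)] R[of T0] T0_nonneg in auto)
    ultimately show ?thesis using s3 by simp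
  qed
  have vS: "v t = 0" if t: "T0 + h \<le> t" "t \<le> S" for t
  proof (rule strong_solution_stops[OF \<gamma> pf sols(1)[OF S] T0_nonneg t(2) \<open>\<delta> > 0\<close> \<delta>])
    show "norm (F (x \<tau>) (v \<tau>) + - g (xz T0)) \<le> \<delta> / 2" if "\<tau> \<in> {T0..t}" for \<tau>
      by (rule close) (use that t h0 T0_nonneg in auto)
    show "norm (v T0) \<le> c * \<beta>"
      using near1(2)[of T0] vz[of T0] T0_nonneg by (simp add: S_def)
    show "T0 + 4 * (c * \<beta>) / \<delta> \<le> t" using t by (simp add: h_def)
  qed
  have v_S: "v S = 0" by (rule vS) (use s2 in \<open>auto simp: S_def\<close>)
  have "norm (g (x S) - g (xz T0)) \<le> \<delta> / 2"
    using close[of S] v_S S h0 by (simp add: S_def F0)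
  hence "- g (x S) \<in> subdifferential \<phi> 0"
    using \<delta> \<open>\<delta> > 0\<close> by (auto simp: dist_norm norm_minus_commute intro!: subsetD[OF \<delta>])
  note rest = global_strong_solution_rest[OF \<gamma> pf sol F0 F \<open>0 \<le> \<beta>\<close> less_imp_le[OF S] v_S this]
  have v_late: "v t = 0" if "T0 + h \<le> t" for t
    using vS[OF that] rest(2)[of t] by (cases "t \<le> S") auto
  have le: "stopping_time v \<le> ereal (T0 + h)"
    by (rule stopping_time_le) (use T0_nonneg h0 v_late in auto)
  then obtain T where T: "stopping_time v = ereal T"
    using stopping_time_nonneg[of v] by (cases "stopping_time v") auto
  have T_le: "T \<le> T0 + h" and T_nonneg: "0 \<le> T"
    using le stopping_time_nonneg[of v] by (auto simp: T)
  have v_T: "v t = 0" if "T \<le> t" for t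
    by (rule stopping_time_rest[OF _ T that]) (rule strong_solution_continuous_on[OF sols(1)])
  have x_T: "x t = x S" if "T \<le> t" for t
  proof (cases "t \<le> S")
    case True
    have "x S = x t"
      by (rule strong_solution_fixed[OF sols(1)[OF S]]) (use T_nonneg that True v_T in auto)
    thus ?thesis by simp
  qed (use rest[of t] in auto)
  \<comment> \<open>Roles exchanged: after \<open>T\<close> the perturbed velocity is zero, so the
    reference has speed at most \<open>c * \<beta>\<close> and, before \<open>T0\<close>, lies
    within \<open>c * \<beta> * T0\<close> of its rest point.\<close>
  have "stopping_time vz \<le> ereal (T + 4 * (c * \<beta>) / \<delta>)"
  proof (rule stopping_time_le_add[OF \<gamma> pf sols(2)[OF S] T_nonneg \<open>\<delta> > 0\<close> \<delta>])
    fix \<tau> assume \<tau>: "\<tau> \<in> {T..S}"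
    hence \<tau>S: "\<tau> \<in> {0..S}" using T_nonneg by auto
    have "norm (xz \<tau> - xz T0) \<le> c * \<beta> * T0"
    proof (cases "T0 \<le> \<tau>")
      case False
      have "norm (xz T0 - xz \<tau>) \<le> c * \<beta> * (T0 - \<tau>)"
      proof (rule strong_solution_displacement_le[OF sols(2)[OF S]])
        fix r assume "r \<in> {\<tau>..T0}"
        thus "norm (vz r) \<le> c * \<beta>" using near1(2)[of r] v_T[of r] \<tau>S \<tau> by (simp add: S_def)
      qed (use False \<tau>S in \<open>auto simp: S_def\<close>)
      also have "\<dots> \<le> c * \<beta> * T0" using \<tau>S cb by (intro mult_left_mono) auto
      finally show ?thesis by (simp add: norm_minus_commute)
    qed (use xz[of \<tau>] cb T0_nonneg in simp)
    hence "B * norm (xz \<tau> - xz T0) \<le> B * (c * \<beta> * T0)" using \<open>B \<ge> 0\<close> by (rule mult_left_mono)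
    \<comment> \<open>At zero velocity \<open>force_bound\<close> is a Lipschitz estimate for
      \<open>g\<close>.\<close>
    moreover have "norm (F (xz \<tau>) 0 - g (xz T0)) \<le> B * (norm (xz \<tau> - xz T0) + \<beta> * norm (0::'a))"
      by (rule force_boundD[OF FB]) (use R[of \<tau>] R[of T0] R0 T0_nonneg \<tau>S in \<open>auto simp: S_def\<close>)
    ultimately show "norm (g (xz \<tau>) + - g (xz T0)) \<le> \<delta> / 2" using s4 by (simp add: F0)
  next
    show "norm (vz T) \<le> c * \<beta>" using near1(2)[of T] v_T[of T] T_nonneg T_le s2 by (simp add: S_def)
  qed (use vz in \<open>simp add: S_def\<close>)
  hence T_ge: "T0 \<le> T + h" by (simp add: T0 h_def)
  show ?thesis
  proof (rule that[of T])
    show "\<bar>T - T0\<bar> \<le> 4 * c / \<delta> * \<beta>" using T_le T_ge by (simp add: h_def)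
    show "norm (F (x t) (v t) + - g (xz T0)) \<le> \<delta> / 2"
      if "t \<in> {0..T0 + 1}" "T0 - 4 * c / \<delta> * \<beta> \<le> t" for t
      by (rule close) (use that in \<open>auto simp: h_def S_def\<close>)
    show "x t = x (T0 + 1)" if "T \<le> t" for t using x_T[OF that] by (simp add: S_def)
    show "norm (x t) \<le> R + 1 \<and> norm (v t) \<le> R + 1" if "t \<in> {0..T0 + 1}" for t
      using within[of t] that by (simp add: S_def)
    show "T \<le> T0 + 1" using T_le s2 by simp
  qed (fact T T_nonneg v_T)+
qed

section \<open>Comparison of the two regularised systems with each other\<close>

theorem theorem3p8:
  fixes f :: "'a::{real_inner, complete_space} \<Rightarrow> real"
    and gradf :: "'a \<Rightarrow> 'a"
    and hessf :: "'a \<Rightarrow> 'a \<Rightarrow>\<^sub>L 'a"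
    and \<phi> :: "'a \<Rightarrow> ereal"
    and \<gamma> \<kappa> r \<beta>bar \<delta> T0 :: real
    and x\<^sub>0 v\<^sub>0 :: 'a
    and xI vI xE vE :: "real \<Rightarrow> real \<Rightarrow> 'a"
    and xz vz :: "real \<Rightarrow> 'a"
  assumes "\<gamma> > 0"
    and "C2_with f gradf hessf"
    and "bdd_below (range f)"
    and "lipschitz_on_bounded gradf"
    and "bounded_on_bounded hessf"
    and "lipschitz_on_bounded hessf"
    and "\<kappa> \<ge> 0"
    and "\<And>x u. inner (blinfun_apply (hessf x) u) u \<ge> - \<kappa> * (norm u)\<^sup>2"
    and "proper_fun \<phi>" and "lsc_fun \<phi>" and "convex_fun \<phi>"
    and "\<phi> 0 = 0" and "\<And>v. \<phi> v \<ge> 0"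
    and "r > 0" and "cball 0 r \<subseteq> subdifferential \<phi> 0"
    and "v\<^sub>0 \<in> subdifferential_dom \<phi>"
    and "\<beta>bar > 0" and "\<beta>bar * \<kappa> < \<gamma>"
    and "\<And>\<beta>. 0 \<le> \<beta> \<Longrightarrow> \<beta> \<le> \<beta>bar \<Longrightarrow>
           global_strong_solution (implicit_force gradf \<beta>) \<gamma> \<phi> x\<^sub>0 v\<^sub>0 (xI \<beta>) (vI \<beta>)"
    and "\<And>\<beta>. 0 \<le> \<beta> \<Longrightarrow> \<beta> \<le> \<beta>bar \<Longrightarrow>
           global_strong_solution (explicit_force gradf hessf \<beta>) \<gamma> \<phi> x\<^sub>0 v\<^sub>0 (xE \<beta>) (vE \<beta>)"
    and "global_strong_solution (implicit_force gradf 0) \<gamma> \<phi> x\<^sub>0 v\<^sub>0 xz vz"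
    and "global_strong_solution (explicit_force gradf hessf 0) \<gamma> \<phi> x\<^sub>0 v\<^sub>0 xz vz"
    and "stopping_time vz = ereal T0" and "T0 > 0"
    and "\<delta> > 0" and "cball (- gradf (xz T0)) \<delta> \<subseteq> subdifferential \<phi> 0"
  shows "\<exists>\<beta>\<^sub>0 C. 0 < \<beta>\<^sub>0 \<and> \<beta>\<^sub>0 \<le> \<beta>bar \<and> 0 < C \<and>
    (\<forall>\<beta>. 0 < \<beta> \<and> \<beta> \<le> \<beta>\<^sub>0 \<longrightarrow>
      (\<exists>TI TE :: real.
         stopping_time (vI \<beta>) = ereal TI \<and> stopping_time (vE \<beta>) = ereal TE \<and>
         \<bar>TI - TE\<bar> \<le> C * \<beta>\<^sup>2 \<and>
         (SUP t\<in>{0..}. ereal (norm (xI \<beta> t - xE \<beta> t) + norm (vI \<beta> t - vE \<beta> t)))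
           \<le> ereal (C * \<beta>\<^sup>2) \<and>
         norm (xI \<beta> TI - xE \<beta> TE) \<le> C * \<beta>\<^sup>2 \<and>
         \<bar>TI - T0\<bar> \<le> C * \<beta> \<and> \<bar>TE - T0\<bar> \<le> C * \<beta>))"
proof -
  have \<gamma>: "\<gamma> \<ge> 0" using \<open>\<gamma> > 0\<close> by simp
  note pf = \<open>proper_fun \<phi>\<close> and T0_pos = \<open>T0 > 0\<close> and \<delta>_pos = \<open>\<delta> > 0\<close>
    and \<delta> = \<open>cball (- gradf (xz T0)) \<delta> \<subseteq> subdifferential \<phi> 0\<close>
  have force0: "implicit_force gradf 0 = (\<lambda>x v. gradf x)" by (simp add: implicit_force_def fun_eq_iff)
  note ref = assms(21)[unfolded force0]
  have refs: "strong_solution (\<lambda>x v. gradf x) \<gamma> \<phi> x\<^sub>0 v\<^sub>0 (T0 + 1) xz vz"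
    using ref T0_pos by (simp add: global_strong_solution_def)
  have "bounded (xz ` {0..T0 + 1})" "bounded (vz ` {0..T0 + 1})"
    by (intro compact_imp_bounded compact_continuous_image strong_solution_continuous_on[OF refs]; simp)+
  then obtain R1 R2 where "\<And>t. t \<in> {0..T0 + 1} \<Longrightarrow> norm (xz t) \<le> R1"
    "\<And>t. t \<in> {0..T0 + 1} \<Longrightarrow> norm (vz t) \<le> R2"
    unfolding bounded_iff by (metis imageI)
  then obtain R where R: "\<And>t. t \<in> {0..T0 + 1} \<Longrightarrow> norm (xz t) \<le> R \<and> norm (vz t) \<le> R"
    by (meson max.cobounded1 max.cobounded2 order_trans)
  have R0: "R \<ge> 0" using R[of 0] T0_pos order_trans[OF norm_ge_zero] by auto
  note fb = ex_force_bound[OF assms(4,5) less_imp_le[OF \<open>\<beta>bar > 0\<close>]]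
  obtain B where B: "B \<ge> 0" and FB: "\<And>\<beta>. 0 \<le> \<beta> \<Longrightarrow> \<beta> \<le> \<beta>bar \<Longrightarrow>
      force_bound gradf (R + 1) B \<beta> (implicit_force gradf \<beta>)"
    "\<And>\<beta>. 0 \<le> \<beta> \<Longrightarrow> \<beta> \<le> \<beta>bar \<Longrightarrow> force_bound gradf (R + 1) B \<beta> (explicit_force gradf hessf \<beta>)"
    using fb[of "R + 1"] by blast
  obtain A where A: "A \<ge> 0" and FA: "\<And>\<beta> x v x' v'. 0 \<le> \<beta> \<Longrightarrow> \<beta> \<le> \<beta>bar \<Longrightarrow>
      norm x \<le> R + 1 \<Longrightarrow> norm v \<le> R + 1 \<Longrightarrow> norm x' \<le> R + 1 \<Longrightarrow> norm v' \<le> R + 1 \<Longrightarrow>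
      norm (implicit_force gradf \<beta> x v - explicit_force gradf hessf \<beta> x' v')
        \<le> A * (norm (x - x') + norm (v - v')) + A * \<beta>\<^sup>2"
    using implicit_explicit_force_diff[OF assms(2,4,5,6) less_imp_le[OF \<open>\<beta>bar > 0\<close>], of "R + 1"] by blast
  \<comment> \<open>Here \<open>c * \<beta>\<close> bounds the distance to the reference,
    \<open>c2 * \<beta>\<^sup>2\<close> the distance between the regularised trajectories, and
    \<open>E\<close> is the coefficient in the smallness condition on
    \<open>\<beta>\<close>.\<close>
  define D c c2 E where "D = sqrt (2 * ((T0 + 1) * exp ((2 + 3 * B) * (T0 + 1))))"
    and "c = B * (R + 1) * D"
    and "c2 = A * sqrt (2 * ((T0 + 1) * exp ((2 + 3 * A) * (T0 + 1))))"
    and "E = c + 4 * c / \<delta> + B * (c + R * (4 * c / \<delta>) + (R + 1)) + B * (c * T0)"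
  have c0: "c \<ge> 0" using B R0 T0_pos by (simp add: c_def D_def)
  have c20: "c2 \<ge> 0" using A T0_pos by (simp add: c2_def)
  have E0: "E \<ge> 0" using c0 B R0 T0_pos \<delta>_pos by (simp add: E_def)
  \<comment> \<open>The denominator \<open>E + 1\<close> is positive even if \<open>E = 0\<close>.
    The summands of \<open>C\<close> cover the distance, the gap between the stopping times, and
    their gap to \<open>T0\<close>; the final 1 makes \<open>C\<close> positive.\<close>
  define \<beta>\<^sub>0 C where "\<beta>\<^sub>0 = min \<beta>bar (min (1 / 2) (\<delta> / 2) / (E + 1))"
    and "C = c2 + 4 * c2 / \<delta> + 4 * c / \<delta> + 1"
  have \<beta>0: "0 < \<beta>\<^sub>0" "\<beta>\<^sub>0 \<le> \<beta>bar" using \<open>\<beta>bar > 0\<close> \<delta>_pos E0 by (auto simp: \<beta>\<^sub>0_def)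
  have q: "4 * c2 / \<delta> \<ge> 0" "4 * c / \<delta> \<ge> 0" using c0 c20 \<delta>_pos by auto
  have C: "C > 0" "c2 \<le> C" "4 * c2 / \<delta> \<le> C" "4 * c / \<delta> \<le> C"
    using q c20 by (auto simp: C_def)
  have main: "\<exists>TI TE :: real.
         stopping_time (vI \<beta>) = ereal TI \<and> stopping_time (vE \<beta>) = ereal TE \<and>
         \<bar>TI - TE\<bar> \<le> C * \<beta>\<^sup>2 \<and>
         (SUP t\<in>{0..}. ereal (norm (xI \<beta> t - xE \<beta> t) + norm (vI \<beta> t - vE \<beta> t)))
           \<le> ereal (C * \<beta>\<^sup>2) \<and>
         norm (xI \<beta> TI - xE \<beta> TE) \<le> C * \<beta>\<^sup>2 \<and>
         \<bar>TI - T0\<bar> \<le> C * \<beta> \<and> \<bar>TE - T0\<bar> \<le> C * \<beta>"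
    if \<beta>: "0 < \<beta>" "\<beta> \<le> \<beta>\<^sub>0" for \<beta>
  proof -
    have b: "0 \<le> \<beta>" "\<beta> \<le> \<beta>bar" using \<beta> \<beta>0 by auto
    have "\<beta> \<le> min (1 / 2) (\<delta> / 2) / (E + 1)" using \<beta> by (simp add: \<beta>\<^sub>0_def)
    hence "(E + 1) * \<beta> \<le> min (1 / 2) (\<delta> / 2)" using E0 by (simp add: pos_le_divide_eq mult.commute)
    hence small: "E * \<beta> \<le> min (1 / 2) (\<delta> / 2)" using b(1) by (simp add: distrib_right)
    note solI = assms(19)[OF b] and solE = assms(20)[OF b]
    have fbI: "\<exists>B\<ge>0. force_bound gradf R B \<beta> (implicit_force gradf \<beta>)"
      and fbE: "\<exists>B\<ge>0. force_bound gradf R B \<beta> (explicit_force gradf hessf \<beta>)" for R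
      using fb[of R] b by blast+
    have zI: "implicit_force gradf \<beta> x 0 = gradf x" and zE: "explicit_force gradf hessf \<beta> x 0 = gradf x" for x
      by (simp_all add: implicit_force_def explicit_force_def blinfun.zero_right)
    note stops = perturbed_solution_stops[OF \<gamma> pf ref assms(23) \<delta>_pos \<delta> R B D_def c_def]
    obtain TI where I: "stopping_time (vI \<beta>) = ereal TI" "0 \<le> TI" "TI \<le> T0 + 1"
      "\<bar>TI - T0\<bar> \<le> 4 * c / \<delta> * \<beta>"
      "\<And>t. TI \<le> t \<Longrightarrow> vI \<beta> t = 0" "\<And>t. TI \<le> t \<Longrightarrow> xI \<beta> t = xI \<beta> (T0 + 1)"
      "\<And>t. t \<in> {0..T0 + 1} \<Longrightarrow> norm (xI \<beta> t) \<le> R + 1 \<and> norm (vI \<beta> t) \<le> R + 1"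
      "\<And>t. t \<in> {0..T0 + 1} \<Longrightarrow> T0 - 4 * c / \<delta> * \<beta> \<le> t \<Longrightarrow>
         norm (implicit_force gradf \<beta> (xI \<beta> t) (vI \<beta> t) + (- gradf (xz T0))) \<le> \<delta> / 2"
      by (rule stops[OF _ solI zI FB(1)[OF b] fbI b(1) small[unfolded E_def]]) blast+
    obtain TE where E: "stopping_time (vE \<beta>) = ereal TE" "0 \<le> TE" "TE \<le> T0 + 1"
      "\<bar>TE - T0\<bar> \<le> 4 * c / \<delta> * \<beta>"
      "\<And>t. TE \<le> t \<Longrightarrow> vE \<beta> t = 0" "\<And>t. TE \<le> t \<Longrightarrow> xE \<beta> t = xE \<beta> (T0 + 1)"
      "\<And>t. t \<in> {0..T0 + 1} \<Longrightarrow> norm (xE \<beta> t) \<le> R + 1 \<and> norm (vE \<beta> t) \<le> R + 1"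
      "\<And>t. t \<in> {0..T0 + 1} \<Longrightarrow> T0 - 4 * c / \<delta> * \<beta> \<le> t \<Longrightarrow>
         norm (explicit_force gradf hessf \<beta> (xE \<beta> t) (vE \<beta> t) + (- gradf (xz T0))) \<le> \<delta> / 2"
      by (rule stops[OF _ solE zE FB(2)[OF b] fbE b(1) small[unfolded E_def]]) blast+
    have S: "T0 + 1 > 0" using T0_pos by simp
    have sI: "strong_solution (implicit_force gradf \<beta>) \<gamma> \<phi> x\<^sub>0 v\<^sub>0 (T0 + 1) (xI \<beta>) (vI \<beta>)"
      and sE: "strong_solution (explicit_force gradf hessf \<beta>) \<gamma> \<phi> x\<^sub>0 v\<^sub>0 (T0 + 1) (xE \<beta>) (vE \<beta>)"
      using solI solE S by (auto simp: global_strong_solution_def)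
    \<comment> \<open>Direct comparison with equal initial data and force error
      \<open>A * \<beta>\<^sup>2\<close>; going through the reference would only give order
      \<open>\<beta>\<close>.\<close>
    have diff: "norm (xI \<beta> t - xE \<beta> t) + norm (vI \<beta> t - vE \<beta> t) \<le> c2 * \<beta>\<^sup>2" if t: "t \<in> {0..T0 + 1}" for t
    proof -
      have "(norm (xI \<beta> t - xE \<beta> t))\<^sup>2 + (norm (vI \<beta> t - vE \<beta> t))\<^sup>2
        \<le> ((norm (xI \<beta> 0 - xE \<beta> 0))\<^sup>2 + (norm (vI \<beta> 0 - vE \<beta> 0))\<^sup>2 + (A * \<beta>\<^sup>2)\<^sup>2 * (t - 0))
          * exp ((2 + 3 * A) * (t - 0))"
        by (rule strong_solution_compare[OF \<gamma> pf sI sE _ _ _ A FA[OF b]]) (use t I(7) E(7) in auto)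
      also have "\<dots> = (A * \<beta>\<^sup>2)\<^sup>2 * (t * exp ((2 + 3 * A) * t))"
        using sI sE by (simp add: strong_solution_def)
      also have "\<dots> \<le> (A * \<beta>\<^sup>2)\<^sup>2 * ((T0 + 1) * exp ((2 + 3 * A) * (T0 + 1)))"
        using t A by (intro mult_left_mono mult_mono iffD2[OF exp_le_cancel_iff]) auto
      finally have "norm (xI \<beta> t - xE \<beta> t) + norm (vI \<beta> t - vE \<beta> t)
          \<le> A * \<beta>\<^sup>2 * sqrt (2 * ((T0 + 1) * exp ((2 + 3 * A) * (T0 + 1))))"
        by (rule add_le_of_sum_squares_le) (use A in simp)
      thus ?thesis by (simp add: c2_def mult_ac)
    qed
    have diffx: "norm (xI \<beta> t - xE \<beta> t) \<le> c2 * \<beta>\<^sup>2" and diffv: "norm (vI \<beta> t - vE \<beta> t) \<le> c2 * \<beta>\<^sup>2"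
      if t: "t \<in> {0..T0 + 1}" for t
      using diff[OF t] norm_ge_zero[of "xI \<beta> t - xE \<beta> t"] norm_ge_zero[of "vI \<beta> t - vE \<beta> t"] by linarith+
    \<comment> \<open>At \<open>TI\<close> the implicit trajectory rests, so the explicit speed is
      at most \<open>c2 * \<beta>\<^sup>2\<close>. The margin holds from \<open>TI\<close> on
      because \<open>TI\<close> is at least \<open>T0 - 4 * c / \<delta> * \<beta>\<close>.\<close>
    have "stopping_time (vE \<beta>) \<le> ereal (TI + 4 * (c2 * \<beta>\<^sup>2) / \<delta>)"
    proof (rule stopping_time_le_add[OF \<gamma> pf sE I(2) \<delta>_pos \<delta>])
      show "norm (vE \<beta> TI) \<le> c2 * \<beta>\<^sup>2" using diffv[of TI] I(2,3) I(5)[of TI] by simp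
      show "norm (explicit_force gradf hessf \<beta> (xE \<beta> \<tau>) (vE \<beta> \<tau>) + - gradf (xz T0)) \<le> \<delta> / 2"
        if "\<tau> \<in> {TI..T0 + 1}" for \<tau>
        by (rule E(8)) (use I(2,4) that in auto)
      show "vE \<beta> t = 0" if "T0 + 1 \<le> t" for t using E(3) that by (intro E(5)) simp
    qed
    moreover have "stopping_time (vI \<beta>) \<le> ereal (TE + 4 * (c2 * \<beta>\<^sup>2) / \<delta>)"
    proof (rule stopping_time_le_add[OF \<gamma> pf sI E(2) \<delta>_pos \<delta>])
      show "norm (vI \<beta> TE) \<le> c2 * \<beta>\<^sup>2" using diffv[of TE] E(2,3) E(5)[of TE] by simp
      show "norm (implicit_force gradf \<beta> (xI \<beta> \<tau>) (vI \<beta> \<tau>) + - gradf (xz T0)) \<le> \<delta> / 2"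
        if "\<tau> \<in> {TE..T0 + 1}" for \<tau>
        by (rule I(8)) (use E(2,4) that in auto)
      show "vI \<beta> t = 0" if "T0 + 1 \<le> t" for t using I(3) that by (intro I(5)) simp
    qed
    ultimately have "\<bar>TI - TE\<bar> \<le> 4 * c2 / \<delta> * \<beta>\<^sup>2"
      using I(1) E(1) by simp
    also have "\<dots> \<le> C * \<beta>\<^sup>2" using C by (intro mult_right_mono) auto
    finally have dT: "\<bar>TI - TE\<bar> \<le> C * \<beta>\<^sup>2" .
    have c2C: "c2 * \<beta>\<^sup>2 \<le> C * \<beta>\<^sup>2" using C by (intro mult_right_mono) auto
    have "norm (xI \<beta> t - xE \<beta> t) + norm (vI \<beta> t - vE \<beta> t) \<le> C * \<beta>\<^sup>2" if "0 \<le> t" for t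
    proof (cases "t \<le> T0 + 1")
      case True
      with diff[of t] that c2C show ?thesis by auto
    next
      case False
      with diffx[of "T0 + 1"] c2C T0_pos I(3) I(5,6)[of t] E(3) E(5,6)[of t] show ?thesis by auto
    qed
    hence "(SUP t\<in>{0..}. ereal (norm (xI \<beta> t - xE \<beta> t) + norm (vI \<beta> t - vE \<beta> t))) \<le> ereal (C * \<beta>\<^sup>2)"
      by (intro SUP_least) auto
    \<comment> \<open>Each position at its own stopping time equals the one at
      \<open>T0 + 1\<close>, so the two can be compared at a common time.\<close>
    moreover have "norm (xI \<beta> TI - xE \<beta> TE) \<le> C * \<beta>\<^sup>2"
      using diffx[of "T0 + 1"] c2C T0_pos I(6)[of TI] E(6)[of TE] by auto
    moreover have "4 * c / \<delta> * \<beta> \<le> C * \<beta>" using C b by (intro mult_right_mono) auto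
    ultimately show ?thesis
      using I(1,4) E(1,4) dT by (intro exI[of _ TI] exI[of _ TE]) auto
  qed
  with \<beta>0 C(1) show ?thesis by blast
qed

end
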